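(* Let $0<\alpha\le 1$ and $0<d<\pi$, and write $\mathscr{D}=\psi^{\mathrm{SE}}(\mathscr{D}_d)$. Let $gQ$ and $\mu Q$ belong to $\mathbf{L}_{\alpha}(\mathscr{D})$. Moreover, let $k(z,\cdot)Q(\cdot)\in\mathbf{L}_{\alpha}(\mathscr{D})$ for all $z\in\mathscr{D}$ and let $k(\cdot,w)Q(w)\in\mathbf{H}^{\infty}(\mathscr{D})$ for all $w\in\mathscr{D}$. Let $u$ be the solution of the initial value problem $$u'(t)=g(t)+\mu(t)u(t)+\int_a^t k(t,r)u(r)\,dr\quad (a\le t\le b),\qquad u(a)=u_a .$$ Then $gQ$, $\mu uQ$ and $(\mathcal{V}u)Q$ belong to $\mathbf{L}_{\alpha}(\mathscr{D})$, and $k(s,\cdot)u(\cdot)Q(\cdot)\in\mathbf{L}_{\alpha}(\mathscr{D})$ for all $s\in[a,b]$.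
   Context: Let $a<b$ be real numbers and $u_a$ a given initial value. Set $Q(z)=(z-a)(b-z)$ and $\mathcal{V}[u](s)=\int_a^s k(s,r)u(r)\,dr$. The initial value problem is treated in its integrated form $u(t)=u_a+\int_a^t\{g(s)+\mu(s)u(s)+\mathcal{V}[u](s)\}\,ds$, $a\le t\le b$. Endpoint singularities of $g$ are allowed. Functions are regarded as functions of complex variables. For $d>0$, $\mathscr{D}_d=\{\zeta\in\mathbb{C}:|\operatorname{Im}\zeta|<d\}$. The SE transformation is $\psi^{\mathrm{SE}}(x)=\frac{b-a}{2}\tanh\left(\frac{x}{2}\right)+\frac{b+a}{2}$, which maps $\mathbb{R}$ onto $(a,b)$, and $\psi^{\mathrm{SE}}(\mathscr{D}_d)=\{z=\psi^{\mathrm{SE}}(\zeta):\zeta\in\mathscr{D}_d\}$. For $\alpha>0$ and a bounded simply connected domain $\mathscr{D}\supset(a,b)$, $\mathbf{L}_{\alpha}(\mathscr{D})$ is the family of functions $f$ that are analytic on $\mathscr{D}$ and for which there is a constant $K$ with $|f(z)|\le K|Q(z)|^{\alpha}$ for all $z\in\mathscr{D}$. $\mathbf{H}^{\infty}(\mathscr{D})$ is the family of functions $f$ analytic on $\mathscr{D}$ with $\|f\|_{\mathbf{H}^{\infty}(\mathscr{D})}=\sup_{z\in\mathscr{D}}|f(z)|<\infty$.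
   Formalization: The bound for k(z,·)Q(·) in L_α(D) is assumed with one constant K for all z in D, and k(a,·)Q and k(b,·)Q are assumed to lie in L_α(D), since a and b are not in D; without these assumptions the claim is false. *)

theory Defs
  imports "HOL-Complex_Analysis.Complex_Analysis"
begin

definition strip :: "real \<Rightarrow> complex set" where
  "strip d = {\<zeta>. \<bar>Im \<zeta>\<bar> < d}"

definition psi_SE :: "real \<Rightarrow> real \<Rightarrow> complex \<Rightarrow> complex" where
  "psi_SE a b \<zeta> = of_real ((b - a) / 2) * tanh (\<zeta> / 2) + of_real ((b + a) / 2)"

definition Qfun :: "real \<Rightarrow> real \<Rightarrow> complex \<Rightarrow> complex" where
  "Qfun a b z = (z - of_real a) * (of_real b - z)"

definition L_space :: "real \<Rightarrow> real \<Rightarrow> real \<Rightarrow> complex set \<Rightarrow> (complex \<Rightarrow> complex) set" where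
  "L_space a b \<alpha> D =
     {f. f analytic_on D \<and> (\<exists>K. \<forall>z\<in>D. norm (f z) \<le> K * norm (Qfun a b z) powr \<alpha>)}"

definition H_infty :: "complex set \<Rightarrow> (complex \<Rightarrow> complex) set" where
  "H_infty D = {f. f analytic_on D \<and> bounded (f ` D)}"

text \<open>
  The Volterra operator on the real interval, and its continuation to complex \<open>z\<close>. When
  \<open>D\<close> is the image of a strip of half-width less than \<open>pi\<close> under \<open>psi_SE a b\<close>, it is a lens or a
  union of two discs having \<open>a\<close> and \<open>b\<close> on their boundaries, so for \<open>z\<close> in \<open>D\<close> the segment from
  \<open>a\<close> to \<open>z\<close> lies in \<open>D\<close> except for its initial point; the integral from \<open>a\<close> to \<open>z\<close> of a function
  analytic on \<open>D\<close> is taken along this segment. The integrand may be singular at \<open>a\<close>.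
\<close>

definition volterra_real ::
  "(complex \<Rightarrow> complex \<Rightarrow> complex) \<Rightarrow> real \<Rightarrow> (real \<Rightarrow> complex) \<Rightarrow> real \<Rightarrow> complex" where
  "volterra_real k a u s = integral {a..s} (\<lambda>r. k (of_real s) (of_real r) * u r)"

definition volterra ::
  "(complex \<Rightarrow> complex \<Rightarrow> complex) \<Rightarrow> real \<Rightarrow> (complex \<Rightarrow> complex) \<Rightarrow> complex \<Rightarrow> complex" where
  "volterra k a U z = contour_integral (linepath (of_real a) z) (\<lambda>w. k z w * U w)"

text \<open>
  Because \<open>g\<close>, \<open>\<mu>\<close> and \<open>k\<close> may be singular at the endpoints, a solution of the initial value
  problem is a solution of its integrated form, all integrals being required to exist. The case
  \<open>t = a\<close> gives the initial condition, and continuity of \<open>u\<close> on \<open>{a..b}\<close> follows.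
\<close>

definition solves_IVP ::
  "real \<Rightarrow> real \<Rightarrow> complex \<Rightarrow> (complex \<Rightarrow> complex) \<Rightarrow> (complex \<Rightarrow> complex) \<Rightarrow>
   (complex \<Rightarrow> complex \<Rightarrow> complex) \<Rightarrow> (real \<Rightarrow> complex) \<Rightarrow> bool" where
  "solves_IVP a b u\<^sub>a g \<mu> k u \<longleftrightarrow>
     (\<forall>s\<in>{a..b}. (\<lambda>r. k (of_real s) (of_real r) * u r) integrable_on {a..s}) \<and>
     (\<forall>t\<in>{a..b}.
        ((\<lambda>s. g (of_real s) + \<mu> (of_real s) * u s + volterra_real k a u s)
           has_integral (u t - u\<^sub>a)) {a..t})"

text \<open>
  Membership of the family \<open>F s\<close>, for \<open>s\<close> in \<open>S\<close>, in \<open>L_space\<close> with a bound independent of \<open>s\<close>.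
  Kernels are required to lie in \<open>L_space\<close> in this sense: with a constant that may depend on the
  first argument, \<open>volterra k a U\<close> need not be bounded near boundary points of \<open>D\<close> other than
  \<open>a\<close> and \<open>b\<close>. For example, if \<open>\<phi>\<close> maps \<open>D\<close> analytically into the unit disc and tends to \<open>1\<close> at
  such a point, \<open>k z w = 1 / (1 - \<phi> z * \<phi> w) ^ 2\<close> is bounded in each variable separately but not
  jointly.
\<close>

definition L_space_uniformly ::
  "real \<Rightarrow> real \<Rightarrow> real \<Rightarrow> complex set \<Rightarrow> 's set \<Rightarrow> ('s \<Rightarrow> complex \<Rightarrow> complex) \<Rightarrow> bool" where
  "L_space_uniformly a b \<alpha> D S F \<longleftrightarrow>
     (\<forall>s\<in>S. F s \<in> L_space a b \<alpha> D) \<and>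
     (\<exists>K. \<forall>s\<in>S. \<forall>z\<in>D. norm (F s z) \<le> K * norm (Qfun a b z) powr \<alpha>)"

end

theory Submission
  imports Defs
begin

text \<open>
  The one thing that is not immediate is that the solution \<open>u\<close>, which is given only on the real
  interval, continues to a bounded analytic function \<open>U\<close> on \<open>D\<close>: multiplying a function of
  \<open>L_space\<close> by a bounded analytic function stays in \<open>L_space\<close>, and \<open>volterra k a U\<close> is bounded, while
  \<open>\<bar>Qfun a b z\<bar>\<close> is at most a constant times its power \<open>\<alpha>\<close> because \<open>D\<close> is bounded and \<open>\<alpha> \<le> 1\<close>.

  The continuation is the sum of the Neumann series of the Volterra equation, in which every integral
  from \<open>a\<close> to \<open>z\<close> is taken along the segment. The segments stay in \<open>D\<close>: the Moebius map
  \<open>z \<mapsto> (b - z) / (z - a)\<close> carries \<open>D\<close> to the sector of half-angle \<open>d\<close> (\<open>mem_psi_SE_image_iff\<close>), and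
  moving towards \<open>a\<close> dilates a point of the sector and adds a positive real to it.

  All estimates depend on \<open>w\<close> only through \<open>s = \<bar>w - a\<bar>\<close>. Since \<open>\<bar>b - w\<bar> \<ge> \<bar>(b - a) - s\<bar>\<close>, the
  hypotheses bound \<open>g\<close>, \<open>\<mu>\<close> and \<open>k z\<close> by \<open>q s\<close>, where \<open>q\<close> is integrable and has an elementary
  primitive \<open>Q\<close> (\<open>Qfun_powr_le_majorant\<close>), whichever the direction of \<open>w - a\<close>; only
  the circle \<open>s = b - a\<close>, which a segment meets at most once, has to be left out. With the weight
  \<open>exp (2 * (Q s + s))\<close> the integral operator halves every bound (\<open>volterra_op_weighted\<close>), so the
  series converges geometrically and uniformly on \<open>D\<close> (\<open>neumann_series\<close>). The same halving on the
  real interval shows that \<open>u\<close> minus the partial sums tends to zero, so that \<open>U\<close> agrees with \<open>u\<close>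
  there (\<open>real_solution_eq_neumann_series\<close>).

  It remains to see that \<open>z \<mapsto> \<integral> k z w * U w dw\<close> is analytic although \<open>z\<close> occurs both in the kernel and
  as end point (\<open>holomorphic_on_ray_integral\<close>). By a lemma of Osgood, separate analyticity and a joint
  bound make the kernel jointly continuous; Cauchy's formula then makes its restriction to the diagonal
  analytic, which handles the integrand at each point of the parametrised segment, and Morera's theorem
  with Fubini's handles the integral. The singularity at \<open>a\<close> is removed by a uniform limit.
\<close>

section \<open>The image of the strip\<close>

text \<open>
  For \<open>0 < d < pi\<close> the sector \<open>\<bar>Arg x\<bar> < d\<close>, without \<open>0\<close>. This form avoids \<open>Arg\<close>: openness is immediate, and
  adding a positive real is controlled by the triangle inequality.
\<close>

definition sector :: "real \<Rightarrow> complex set" where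
  "sector d = {x. norm x * cos d < Re x}"

lemma open_sector: "open (sector d)"
  unfolding sector_def by (intro open_Collect_less continuous_intros)

lemma exp_image_strip:
  assumes "0 < d" "d < pi"
  shows "exp ` strip d = sector d"
proof (intro equalityI subsetI)
  fix x assume "x \<in> exp ` strip d"
  then obtain \<zeta> where \<zeta>: "x = exp \<zeta>" "\<bar>Im \<zeta>\<bar> < d"
    by (auto simp: strip_def)
  have "cos d < cos \<bar>Im \<zeta>\<bar>"
    using \<zeta> assms by (intro cos_monotone_0_pi) auto
  then show "x \<in> sector d"
    by (simp add: sector_def \<zeta> Re_exp)
next
  fix x assume x: "x \<in> sector d"
  then have "x \<noteq> 0"
    by (auto simp: sector_def)
  then have eq: "exp (Ln x) = x"
    by simp
  have "norm x * cos d < norm x * cos (Im (Ln x))"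
    using x \<open>x \<noteq> 0\<close> by (metis (no_types, lifting) Re_exp eq mem_Collect_eq norm_exp_eq_Re sector_def)
  then have "cos d < cos \<bar>Im (Ln x)\<bar>"
    using \<open>x \<noteq> 0\<close> by (simp add: mult_less_cancel_left)
  moreover have "\<bar>Im (Ln x)\<bar> \<le> pi"
    using Im_Ln_le_pi[OF \<open>x \<noteq> 0\<close>] mpi_less_Im_Ln[OF \<open>x \<noteq> 0\<close>] by linarith
  ultimately have "\<bar>Im (Ln x)\<bar> < d"
    using assms cos_mono_less_eq[of d "\<bar>Im (Ln x)\<bar>"] by auto
  then show "x \<in> exp ` strip d"
    using eq by (metis (mono_tags, lifting) image_eqI mem_Collect_eq strip_def)
qed

text \<open>
  Adding \<open>c \<ge> 0\<close> raises the real part by \<open>c\<close> and changes \<open>norm x * cos d\<close> by at most \<open>\<bar>cos d\<bar> * c\<close>,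
  whatever the sign of \<open>cos d\<close>.
\<close>

lemma sector_add_real:
  assumes "x \<in> sector d" "0 \<le> c"
  shows "x + of_real c \<in> sector d"
proof -
  have "\<bar>norm (x + of_real c) - norm x\<bar> \<le> c"
    using norm_triangle_ineq3[of "x + of_real c" x] assms(2) by simp
  then have "\<bar>cos d\<bar> * \<bar>norm (x + of_real c) - norm x\<bar> \<le> 1 * c"
    by (intro mult_mono) auto
  then have "cos d * (norm (x + of_real c) - norm x) \<le> c"
    by (metis abs_ge_self abs_mult dual_order.trans mult_1)
  then show ?thesis
    using assms(1) by (simp add: sector_def algebra_simps)
qed

lemma sector_scale:
  assumes "x \<in> sector d" "0 < c"
  shows "x * of_real c \<in> sector d"
proof -
  have "(norm x * cos d) * c < Re x * c"
    using assms by (intro mult_strict_right_mono) (auto simp: sector_def)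
  then show ?thesis
    using assms(2) by (simp add: sector_def norm_mult mult_ac)
qed

text \<open>
  \<open>sin d\<close> is the distance from \<open>-1\<close> to the boundary ray of a sector of half-angle \<open>d \<ge> pi / 2\<close>; it is
  a lower bound for smaller \<open>d\<close> as well. In the coordinate \<open>z\<close> this makes the domain bounded.
\<close>

lemma norm_one_plus_sector:
  assumes "x \<in> sector d" "0 < d" "d < pi"
  shows "sin d \<le> norm (1 + x)"
proof -
  have "(sin d)\<^sup>2 = 1 - (cos d)\<^sup>2"
    using sin_squared_eq by blast
  also have "\<dots> \<le> 1 - (cos d)\<^sup>2 + (norm x + cos d)\<^sup>2"
    by simp
  also have "\<dots> = 1 + 2 * (norm x * cos d) + (norm x)\<^sup>2"
    by (simp add: power2_eq_square algebra_simps)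
  also have "\<dots> \<le> 1 + 2 * Re x + (norm x)\<^sup>2"
    using assms(1) by (simp add: sector_def)
  also have "\<dots> = (norm (1 + x))\<^sup>2"
    unfolding cmod_power2 by (simp add: power2_eq_square algebra_simps)
  finally show ?thesis
    by (rule power2_le_imp_le) simp
qed

lemma minus_one_notin_sector:
  assumes "0 < d" "d < pi" shows "-1 \<notin> sector d"
  using norm_one_plus_sector[of "-1" d] sin_gt_zero[OF assms] assms by auto

lemma psi_SE_eq:
  assumes "1 + exp (- \<zeta>) \<noteq> 0"
  shows "psi_SE a b \<zeta> = of_real a + of_real (b - a) / (1 + exp (- \<zeta>))"
proof -
  define e where "e = exp (\<zeta> / 2)"
  have e: "e \<noteq> 0" "exp (- (\<zeta> / 2)) = 1 / e"
    by (simp_all add: e_def exp_minus field_simps)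
  have "exp (- \<zeta>) = exp (- (\<zeta> / 2)) * exp (- (\<zeta> / 2))"
    by (simp flip: exp_add)
  then have e2: "exp (- \<zeta>) = 1 / (e * e)"
    by (simp add: e)
  with assms e have ne: "e * e + 1 \<noteq> 0"
    by (auto simp: field_simps)
  have "tanh (\<zeta> / 2) = (e * e - 1) / (e * e + 1)"
  proof -
    have "e - 1 / e = (e * e - 1) / e" "e + 1 / e = (e * e + 1) / e"
      using e by (simp_all add: field_simps)
    then show ?thesis
      using e by (simp add: tanh_altdef e flip: e_def)
  qed
  moreover have "1 / (1 + exp (- \<zeta>)) = e * e / (e * e + 1)"
    using e ne by (simp add: e2 field_simps)
  moreover have "of_real (b - a) / (1 + exp (- \<zeta>)) = of_real (b - a) * (1 / (1 + exp (- \<zeta>)))"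
    by simp
  moreover have "of_real ((b - a) / 2) * ((E - 1) / (E + 1)) + of_real ((b + a) / 2) =
      of_real a + of_real (b - a) * (E / (E + 1))" if "E + 1 \<noteq> 0" for E :: complex
  proof -
    have "2 + E * 2 = 2 * (E + 1)"
      by simp
    then have "2 + E * 2 \<noteq> 0"
      using that by (metis mult_eq_0_iff zero_neq_numeral)
    then show ?thesis
      using that by (simp add: divide_simps) (simp add: algebra_simps)
  qed
  ultimately show ?thesis
    using ne unfolding psi_SE_def by metis
qed

text \<open>
  For \<open>z = psi_SE a b \<zeta>\<close> the quotient \<open>(b - z) / (z - a) = (b - a) / (z - a) - 1\<close> equals \<open>exp (- \<zeta>)\<close>,
  and \<open>exp\<close> maps the symmetric strip onto the sector. At \<open>z = a\<close> the convention \<open>x / 0 = 0\<close> gives \<open>-1\<close>,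
  which lies outside the sector, so that the equivalence holds for all \<open>z\<close>.
\<close>

lemma mem_psi_SE_image_iff:
  assumes "a < b" "0 < d" "d < pi"
  shows "z \<in> psi_SE a b ` strip d \<longleftrightarrow> of_real (b - a) / (z - of_real a) - 1 \<in> sector d"
proof
  assume "z \<in> psi_SE a b ` strip d"
  then obtain \<zeta> where \<zeta>: "z = psi_SE a b \<zeta>" "\<zeta> \<in> strip d"
    by blast
  then have "-\<zeta> \<in> strip d"
    by (simp add: strip_def)
  then have s: "exp (-\<zeta>) \<in> sector d"
    using exp_image_strip[of d] assms by blast
  have "sin d > 0"
    using assms by (simp add: sin_gt_zero)
  then have ne: "1 + exp (-\<zeta>) \<noteq> 0"
    using norm_one_plus_sector[OF s] assms by auto
  have "of_real (b - a) / (z - of_real a) - 1 = exp (-\<zeta>)"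
    using ne assms unfolding \<zeta>(1) psi_SE_eq[OF ne] by (simp add: field_simps)
  then show "of_real (b - a) / (z - of_real a) - 1 \<in> sector d"
    using s by simp
next
  assume s: "of_real (b - a) / (z - of_real a) - 1 \<in> sector d"
  then obtain \<zeta> where \<zeta>: "of_real (b - a) / (z - of_real a) - 1 = exp \<zeta>" "\<zeta> \<in> strip d"
    using exp_image_strip[of d] assms by blast
  then have mem: "-\<zeta> \<in> strip d"
    by (simp add: strip_def)
  have za: "z \<noteq> of_real a"
    using s minus_one_notin_sector[of d] assms by auto
  have eq: "1 + exp (- (- \<zeta>)) = of_real (b - a) / (z - of_real a)"
    using \<zeta>(1) by (simp add: field_simps)
  have "1 + exp (- (- \<zeta>)) \<noteq> 0"
    unfolding eq using assms za by (simp del: of_real_diff)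
  from psi_SE_eq[OF this, of a b] have "psi_SE a b (-\<zeta>) = z"
    unfolding eq using assms za by (simp del: of_real_diff)
  then show "z \<in> psi_SE a b ` strip d"
    using mem by blast
qed

lemma open_psi_SE_image:
  assumes "a < b" "0 < d" "d < pi"
  shows "open (psi_SE a b ` strip d)"
proof -
  have eq: "psi_SE a b ` strip d =
      (- {of_real a}) \<inter> (\<lambda>z. of_real (b - a) / (z - of_real a) - 1) -` sector d"
  proof (rule set_eqI)
    fix z show "z \<in> psi_SE a b ` strip d \<longleftrightarrow>
        z \<in> - {of_real a} \<inter> (\<lambda>z. of_real (b - a) / (z - of_real a) - 1) -` sector d"
      using minus_one_notin_sector[of d] assms
      by (cases "z = of_real a") (simp_all add: mem_psi_SE_image_iff)
  qed
  show ?thesis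
    unfolding eq
    by (intro continuous_open_preimage continuous_intros open_sector) auto
qed

lemma notin_psi_SE_image:
  assumes "a < b" "0 < d" "d < pi"
  shows "of_real a \<notin> psi_SE a b ` strip d" "of_real b \<notin> psi_SE a b ` strip d"
  using assms minus_one_notin_sector[of d]
  by (subst mem_psi_SE_image_iff; simp add: sector_def flip: of_real_diff)+

text \<open>
  Replacing \<open>z - a\<close> by \<open>t * (z - a)\<close> turns the sector coordinate \<open>x\<close> into \<open>x / t + (1 / t - 1)\<close>.
\<close>

lemma psi_SE_image_ray:
  assumes "a < b" "0 < d" "d < pi" "z \<in> psi_SE a b ` strip d" "0 < t" "t \<le> 1"
  shows "of_real a + of_real t * (z - of_real a) \<in> psi_SE a b ` strip d"
proof -
  define x where "x = of_real (b - a) / (z - of_real a) - 1"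
  have x: "x \<in> sector d"
    using assms mem_psi_SE_image_iff by (simp add: x_def)
  have "x * of_real (1 / t) + of_real (1 / t - 1) \<in> sector d"
    using assms by (intro sector_add_real sector_scale x) auto
  also have "x * of_real (1 / t) + of_real (1 / t - 1) =
      of_real (b - a) / (of_real a + of_real t * (z - of_real a) - of_real a) - 1"
  proof -
    have "x * of_real (1 / t) + of_real (1 / t - 1) = (x + 1) / of_real t - 1"
      by (simp add: add_divide_distrib)
    then show ?thesis
      by (simp add: x_def mult.commute)
  qed
  finally show ?thesis
    using assms mem_psi_SE_image_iff by blast
qed

lemma psi_SE_image_bounded:
  assumes "a < b" "0 < d" "d < pi" "z \<in> psi_SE a b ` strip d"
  shows "norm (z - of_real a) \<le> (b - a) / sin d"
proof -
  define x where "x = of_real (b - a) / (z - of_real a) - 1"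
  have x: "x \<in> sector d"
    using assms mem_psi_SE_image_iff by (simp add: x_def)
  have "z \<noteq> of_real a"
    using notin_psi_SE_image assms by blast
  have "sin d > 0"
    using assms by (simp add: sin_gt_zero)
  have "sin d \<le> norm (1 + x)"
    by (intro norm_one_plus_sector x assms)
  also have "\<dots> = (b - a) / norm (z - of_real a)"
    using assms by (simp add: x_def norm_divide del: of_real_diff)
  finally show ?thesis
    using \<open>z \<noteq> of_real a\<close> \<open>sin d > 0\<close> by (simp add: field_simps)
qed

lemma real_interval_subset_psi_SE_image:
  assumes "a < b" "0 < d" "d < pi" "a < t" "t < b"
  shows "of_real t \<in> psi_SE a b ` strip d"
proof -
  have "of_real (b - a) / (of_real t - of_real a) - 1 = (of_real ((b - t) / (t - a)) :: complex)"
    using assms by (simp add: field_simps)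
  moreover have "cos d < 1"
    using assms cos_monotone_0_pi[of 0 d] by simp
  moreover have pos: "(b - t) / (t - a) > 0"
    using assms by simp
  ultimately show ?thesis
    using assms mult_strict_left_mono[OF \<open>cos d < 1\<close> pos]
    by (simp add: mem_psi_SE_image_iff sector_def del: of_real_divide of_real_diff)
qed

section \<open>Integrals with an integrable singularity\<close>

text \<open>
  Domination is only required away from the end points and a finite set \<open>N\<close>: the majorants used below
  may be singular there, where the value that \<open>powr\<close> assigns to them is no bound.
\<close>

lemma dominated_integrable_Icc:
  fixes f :: "real \<Rightarrow> 'a::euclidean_space" and g :: "real \<Rightarrow> real"
  assumes f: "continuous_on {c<..<d} f" and g: "(g has_integral I) {c..d}"
    and N: "finite N" and le: "\<And>x. x \<in> {c<..<d} - N \<Longrightarrow> norm (f x) \<le> g x"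
  shows "f integrable_on {c..d}"
proof -
  define S where "S = {c<..<d} - N"
  have S: "open S" "S \<subseteq> {c..d}" "negligible ({c..d} - S)"
  proof -
    show "open S"
      unfolding S_def using N by (intro open_Diff finite_imp_closed) auto
    have "{c..d} - S \<subseteq> N \<union> {c, d}"
      by (auto simp: S_def)
    then show "negligible ({c..d} - S)"
      using N by (meson finite.emptyI finite.insertI finite_UnI negligible_finite negligible_subset)
  qed (auto simp: S_def)
  have "S - {c..d} = {}"
    using S(2) by blast
  with S(3) have neg: "negligible (({c..d} - S) \<union> (S - {c..d}))"
    by simp
  have "g integrable_on S"
    using integrable_spike_set_eq[OF neg, of g] has_integral_integrable[OF g] by blast
  moreover have "f \<in> borel_measurable (lebesgue_on S)"
    by (rule continuous_imp_measurable_on_sets_lebesgue) 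
      (use f S in \<open>auto simp: S_def intro: continuous_on_subset\<close>)
  moreover have "norm (f x) \<le> g x" if "x \<in> S" for x
    using le that by (simp add: S_def)
  moreover have "S \<in> sets lebesgue"
    using S(1) by (simp add: borel_open)
  ultimately have "f integrable_on S"
    by (intro measurable_bounded_by_integrable_imp_integrable[of f S g])
  then show ?thesis
    using integrable_spike_set_eq[OF neg, of f] by blast
qed

lemma has_integral_norm_bound:
  fixes f :: "real \<Rightarrow> 'a::euclidean_space" and g :: "real \<Rightarrow> real"
  assumes f: "(f has_integral J) {c..d}" and g: "(g has_integral I) {c..d}"
    and N: "finite N" and le: "\<And>x. x \<in> {c<..<d} - N \<Longrightarrow> norm (f x) \<le> g x"
  shows "norm J \<le> I"
proof -
  define N' where "N' = N \<union> {c, d}"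
  have N': "finite N'"
    using N by (simp add: N'_def)
  have "((\<lambda>x. if x \<in> N' then 0 else f x) has_integral J) {c..d}"
    by (rule has_integral_spike_finite[OF N' _ f]) simp
  moreover have "((\<lambda>x. if x \<in> N' then 0 else g x) has_integral I) {c..d}"
    by (rule has_integral_spike_finite[OF N' _ g]) simp
  ultimately show ?thesis
    using le integral_norm_bound_integral
      [of "\<lambda>x. if x \<in> N' then 0 else f x" "{c..d}" "\<lambda>x. if x \<in> N' then 0 else g x"]
    by (auto simp: N'_def has_integral_iff)
qed

section \<open>A radial majorant for powers of Q\<close>

text \<open>
  The odd extension of \<open>x powr \<alpha>\<close>, which is a primitive of the even function
  \<open>\<alpha> * \<bar>x\<bar> powr (\<alpha> - 1)\<close> across its singularity.
\<close>

definition signed_powr :: "real \<Rightarrow> real \<Rightarrow> real" where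
  "signed_powr \<alpha> x = sgn x * \<bar>x\<bar> powr \<alpha>"

lemma continuous_on_signed_powr:
  assumes "0 < \<alpha>"
  shows "continuous_on A (signed_powr \<alpha>)"
proof -
  have "signed_powr \<alpha> x = max x 0 powr \<alpha> - max (- x) 0 powr \<alpha>" for x
    using assms by (auto simp: signed_powr_def max_def sgn_if)
  then have eq: "signed_powr \<alpha> = (\<lambda>x. max x 0 powr \<alpha> - max (- x) 0 powr \<alpha>)"
    by auto
  show ?thesis
    unfolding eq using assms by (intro continuous_intros continuous_on_powr') auto
qed

lemma DERIV_signed_powr:
  assumes "x \<noteq> 0"
  shows "(signed_powr \<alpha> has_real_derivative \<alpha> * \<bar>x\<bar> powr (\<alpha> - 1)) (at x)"
proof (cases "x > 0")
  case True
  have "((\<lambda>x. x powr \<alpha>) has_real_derivative \<alpha> * \<bar>x\<bar> powr (\<alpha> - 1)) (at x)"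
    using True by (auto intro!: derivative_eq_intros)
  then show ?thesis
    by (rule has_field_derivative_transform_within_open[of _ _ _ "{0<..}"])
      (use True in \<open>auto simp: signed_powr_def\<close>)
next
  case False
  with assms have x: "x < 0" by simp
  have "((\<lambda>x. - ((- x) powr \<alpha>)) has_real_derivative \<alpha> * \<bar>x\<bar> powr (\<alpha> - 1)) (at x)"
    using x by (auto intro!: derivative_eq_intros)
  then show ?thesis
    by (rule has_field_derivative_transform_within_open[of _ _ _ "{..<0}"])
      (use x in \<open>auto simp: signed_powr_def\<close>)
qed

text \<open>
  For \<open>\<alpha> \<le> 1\<close> a bound for \<open>(s * \<bar>s - L\<bar>) powr (\<alpha> - 1)\<close> that separates the two singularities: one of the two
  factors is always at least \<open>L / 2\<close>. Unlike the product, the sum has an elementary primitive, with the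
  constant of integration in \<open>majorant_int\<close> chosen to make it vanish at \<open>0\<close>.
\<close>

definition majorant :: "real \<Rightarrow> real \<Rightarrow> real \<Rightarrow> real" where
  "majorant \<alpha> L s = (L / 2) powr (\<alpha> - 1) * (\<bar>s\<bar> powr (\<alpha> - 1) + \<bar>s - L\<bar> powr (\<alpha> - 1))"

definition majorant_int :: "real \<Rightarrow> real \<Rightarrow> real \<Rightarrow> real" where
  "majorant_int \<alpha> L s = (L / 2) powr (\<alpha> - 1) / \<alpha> *
     (signed_powr \<alpha> s + signed_powr \<alpha> (s - L) + L powr \<alpha>)"

lemma majorant_nonneg: "0 \<le> majorant \<alpha> L s"
  by (simp add: majorant_def)

lemma continuous_on_majorant_int: "0 < \<alpha> \<Longrightarrow> continuous_on A (majorant_int \<alpha> L)"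
  unfolding majorant_int_def[abs_def]
  by (intro continuous_intros continuous_on_signed_powr
      continuous_on_compose2[OF continuous_on_signed_powr[of \<alpha> UNIV]]) auto

lemma DERIV_majorant_int:
  assumes "0 < \<alpha>" "s \<noteq> 0" "s \<noteq> L"
  shows "(majorant_int \<alpha> L has_real_derivative majorant \<alpha> L s) (at s)"
proof -
  have "((\<lambda>s. signed_powr \<alpha> (s - L)) has_real_derivative \<alpha> * \<bar>s - L\<bar> powr (\<alpha> - 1) * 1) (at s)"
    using assms by (intro DERIV_chain2[OF DERIV_signed_powr]) (auto intro!: derivative_eq_intros)
  then show ?thesis
    unfolding majorant_int_def[abs_def] majorant_def using assms
    by (auto intro!: derivative_eq_intros DERIV_signed_powr simp: field_simps)
qed

lemma majorant_int_0: "0 < L \<Longrightarrow> majorant_int \<alpha> L 0 = 0"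
  by (simp add: majorant_int_def signed_powr_def)

text \<open>
  The reverse triangle inequality gives \<open>\<bar>b - w\<bar> \<ge> \<bar>(b - a) - \<bar>w - a\<bar>\<bar>\<close>, so the bound is radial about
  \<open>a\<close>. On the circle about \<open>a\<close> through \<open>b\<close> it degenerates, which is why that circle is excluded.
\<close>

lemma Qfun_powr_le_majorant:
  fixes a b :: real
  assumes "0 < \<alpha>" "\<alpha> \<le> 1" "a < b" "w \<noteq> of_real a" "norm (w - of_real a) \<noteq> b - a"
  shows "norm (Qfun a b w) powr (\<alpha> - 1) \<le> majorant \<alpha> (b - a) (norm (w - of_real a))"
proof -
  define x y where "x = norm (w - of_real a)" and "y = \<bar>x - (b - a)\<bar>"
  have pos: "0 < x" "0 < y"
    using assms by (auto simp: x_def y_def)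
  have "y \<le> norm (of_real b - w)"
    using norm_triangle_ineq3[of "w - of_real a" "of_real (b - a)"] assms(3)
    unfolding y_def x_def by (simp add: norm_minus_commute del: norm_of_real) (simp flip: of_real_diff)
  then have "x * y \<le> norm (Qfun a b w)"
    unfolding Qfun_def norm_mult x_def[symmetric] using pos by (intro mult_left_mono) auto
  then have "norm (Qfun a b w) powr (\<alpha> - 1) \<le> (x * y) powr (\<alpha> - 1)"
    using pos assms by (intro powr_mono2') auto
  also have "\<dots> = x powr (\<alpha> - 1) * y powr (\<alpha> - 1)"
    using pos by (simp add: powr_mult)
  also have "\<dots> \<le> (x powr (\<alpha> - 1) + y powr (\<alpha> - 1)) * ((b - a) / 2) powr (\<alpha> - 1)"
  proof (cases "x \<ge> (b - a) / 2")
    case True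
    then have "x powr (\<alpha> - 1) \<le> ((b - a) / 2) powr (\<alpha> - 1)"
      using assms by (intro powr_mono2') auto
    then have "y powr (\<alpha> - 1) * x powr (\<alpha> - 1) \<le> (x powr (\<alpha> - 1) + y powr (\<alpha> - 1)) * ((b - a) / 2) powr (\<alpha> - 1)"
      by (intro mult_mono) auto
    then show ?thesis by (simp add: mult.commute)
  next
    case False
    then have "y powr (\<alpha> - 1) \<le> ((b - a) / 2) powr (\<alpha> - 1)"
      using assms by (intro powr_mono2') (auto simp: y_def)
    then show ?thesis
      by (intro mult_mono) auto
  qed
  finally show ?thesis
    using pos by (simp add: majorant_def x_def y_def mult.commute)
qed

section \<open>Analytic dependence on parameters\<close>

lemma continuous_on_contour_integral_param:
  fixes f :: "'a::topological_space \<Rightarrow> complex \<Rightarrow> complex"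
  assumes vp: "valid_path h" and hv: "continuous_on {0..1} (\<lambda>t. vector_derivative h (at t))"
    and cont: "continuous_on (S \<times> path_image h) (\<lambda>(z, w). f z w)"
  shows "continuous_on S (\<lambda>z. contour_integral h (f z))"
proof -
  have ch: "continuous_on {0..1} h"
    using vp valid_path_imp_path path_def by blast
  have "continuous_on (S \<times> cbox 0 1) (\<lambda>p. case (fst p, h (snd p)) of (z, w) \<Rightarrow> f z w)"
    by (rule continuous_on_compose2[OF cont])
      (auto intro!: continuous_intros continuous_on_compose2[OF ch] simp: path_image_def)
  then have "continuous_on (S \<times> cbox 0 1) (\<lambda>(z, t). f z (h t) * vector_derivative h (at t))"
    unfolding split_def
    by (intro continuous_intros continuous_on_compose2[OF hv]) auto
  then show ?thesis
    unfolding contour_integral_integral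
    using integral_continuous_on_param[of S 0 1 "\<lambda>z t. f z (h t) * vector_derivative h (at t)"] by simp
qed

lemma contour_integrable_continuous_C1:
  assumes "valid_path h" "continuous_on {0..1} (\<lambda>t. vector_derivative h (at t))"
    and "continuous_on (path_image h) f"
  shows "f contour_integrable_on h"
  unfolding contour_integrable_on
proof (intro integrable_continuous_interval continuous_intros assms)
  show "continuous_on {0..1} (\<lambda>t. f (h t))"
    using assms(1) valid_path_imp_path
    by (intro continuous_on_compose2[OF assms(3)]) (auto simp: path_def path_image_def)
qed

text \<open>
  Morera's theorem: the integral over a triangle may be exchanged with the one along \<open>h\<close>, and then
  Cauchy's theorem applies to each \<open>\<lambda>z. f z w\<close>.
\<close>

lemma holomorphic_on_contour_integral_param:
  assumes D: "open D" and vp: "valid_path h"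
    and hv: "continuous_on {0..1} (\<lambda>t. vector_derivative h (at t))"
    and cont: "continuous_on (D \<times> path_image h) (\<lambda>(z, w). f z w)"
    and hol: "\<And>w. w \<in> path_image h \<Longrightarrow> (\<lambda>z. f z w) holomorphic_on D"
  shows "(\<lambda>z. contour_integral h (f z)) holomorphic_on D"
proof -
  let ?I = "\<lambda>p q w. contour_integral (linepath p q) (\<lambda>z. f z w)"
  have "(\<lambda>z. contour_integral h (f z)) analytic_on D"
  proof (rule Morera_triangle[OF _ D], rule continuous_on_contour_integral_param[OF vp hv cont], rule impI)
    fix p q r assume sub: "convex hull {p, q, r} \<subseteq> D"
    have segs: "closed_segment p q \<subseteq> D" "closed_segment q r \<subseteq> D" "closed_segment r p \<subseteq> D"
      using sub unfolding segment_convex_hull by (meson hull_mono dual_order.trans insert_subsetI empty_subsetI insertCI)+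
    have seg: "contour_integral (linepath x y) (\<lambda>z. contour_integral h (f z)) = contour_integral h (?I x y)
        \<and> ?I x y contour_integrable_on h" if "closed_segment x y \<subseteq> D" for x y
    proof
      have c: "continuous_on (path_image (linepath x y) \<times> path_image h) (\<lambda>(z, w). f z w)"
        using that by (intro continuous_on_subset[OF cont]) auto
      show "contour_integral (linepath x y) (\<lambda>z. contour_integral h (f z)) = contour_integral h (?I x y)"
        by (rule contour_integral_swap[OF c]) (auto simp: vp hv)
      have "continuous_on (path_image h \<times> path_image (linepath x y)) (\<lambda>(w, z). f z w)"
        using continuous_on_compose2[OF c continuous_on_swap, of "path_image h \<times> path_image (linepath x y)"]
        by (force simp: split_def prod.swap_def)
      then have "continuous_on (path_image h) (?I x y)"
        by (intro continuous_on_contour_integral_param) auto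
      then show "?I x y contour_integrable_on h"
        by (rule contour_integrable_continuous_C1[OF vp hv])
    qed
    have "contour_integral h (?I p q) + contour_integral h (?I q r) + contour_integral h (?I r p)
        = contour_integral h (\<lambda>w. ?I p q w + ?I q r w + ?I r p w)"
      using seg segs by (simp add: contour_integral_add contour_integrable_add)
    also have "\<dots> = contour_integral h (\<lambda>w. 0)"
    proof (rule contour_integral_eq)
      fix w assume "w \<in> path_image h"
      then have "(\<lambda>z. f z w) holomorphic_on convex hull {p, q, r}"
        using hol sub holomorphic_on_subset by blast
      then show "?I p q w + ?I q r w + ?I r p w = 0"
        by (intro has_chain_integral_chain_integral3 Cauchy_theorem_triangle)
    qed
    finally show "contour_integral (linepath p q) (\<lambda>z. contour_integral h (f z)) +
       contour_integral (linepath q r) (\<lambda>z. contour_integral h (f z)) +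
       contour_integral (linepath r p) (\<lambda>z. contour_integral h (f z)) = 0"
      using seg segs by simp
  qed
  then show ?thesis
    by (simp add: analytic_imp_holomorphic)
qed

text \<open>
  Osgood's lemma. Cauchy's estimate turns the joint bound into a Lipschitz constant in \<open>z\<close> that does
  not depend on \<open>w\<close>.
\<close>

lemma bounded_separately_holomorphic_imp_continuous:
  fixes F :: "complex \<Rightarrow> 'b::metric_space \<Rightarrow> complex"
  assumes A: "open A" and hol: "\<And>w. w \<in> B \<Longrightarrow> (\<lambda>z. F z w) holomorphic_on A"
    and cont: "\<And>z. z \<in> A \<Longrightarrow> continuous_on B (F z)"
    and bd: "\<And>z w. z \<in> A \<Longrightarrow> w \<in> B \<Longrightarrow> norm (F z w) \<le> K"
  shows "continuous_on (A \<times> B) (\<lambda>(z, w). F z w)"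
  unfolding continuous_on_iff
proof (intro ballI allI impI)
  fix p and e :: real assume p: "p \<in> A \<times> B" and e: "0 < e"
  obtain z0 w0 where zw0: "p = (z0, w0)" "z0 \<in> A" "w0 \<in> B"
    using p by blast
  obtain R where R: "R > 0" "cball z0 (2 * R) \<subseteq> A"
  proof -
    obtain R' where "R' > 0" "cball z0 R' \<subseteq> A"
      using A zw0(2) open_contains_cball by blast
    then show ?thesis by (intro that[of "R' / 2"]) auto
  qed
  have "norm (F z0 w0) \<le> K"
    using bd zw0 by blast
  then have K: "K \<ge> 0"
    by (meson norm_ge_zero order_trans)
  have lip: "norm (F z w - F z0 w) \<le> K / R * norm (z - z0)" if z: "z \<in> ball z0 R" and w: "w \<in> B" for z w
  proof (rule field_differentiable_bound[where S = "ball z0 R" and f' = "deriv (\<lambda>z. F z w)"])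
    fix x assume x: "x \<in> ball z0 R"
    have sub: "cball x R \<subseteq> A"
    proof
      fix y assume "y \<in> cball x R"
      then have "dist z0 y \<le> 2 * R"
        using x dist_triangle[of z0 y x] by simp
      then show "y \<in> A" using R by auto
    qed
    have h: "(\<lambda>z. F z w) holomorphic_on cball x R"
      using hol[OF w] sub holomorphic_on_subset by blast
    have "x \<in> A" using sub R(1) by auto
    then show "((\<lambda>z. F z w) has_field_derivative deriv (\<lambda>z. F z w) x) (at x within ball z0 R)"
      using holomorphic_derivI[OF hol[OF w] A] has_field_derivative_at_within by blast
    \<comment> \<open>the estimate for derivatives of order n is applied with n = 1\<close>
    have "norm ((deriv ^^ 1) (\<lambda>z. F z w) x) \<le> fact 1 * K / R ^ 1"
    proof (rule Cauchy_inequality)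
      show "(\<lambda>z. F z w) holomorphic_on ball x R"
        using h by (rule holomorphic_on_subset) auto
      show "continuous_on (cball x R) (\<lambda>z. F z w)"
        using h by (rule holomorphic_on_imp_continuous_on)
      show "norm (F y w) \<le> K" if "norm (x - y) = R" for y
        using bd w sub that by (auto simp: dist_norm)
    qed (use R in auto)
    then show "norm (deriv (\<lambda>z. F z w) x) \<le> K / R"
      by simp
  qed (use z R in auto)
  obtain d1 where d1: "d1 > 0" "\<And>w. w \<in> B \<Longrightarrow> dist w w0 < d1 \<Longrightarrow> dist (F z0 w) (F z0 w0) < e / 2"
    using cont[OF zw0(2)] zw0(3) e unfolding continuous_on_iff by (meson half_gt_zero)
  define d2 where "d2 = min R (e * R / (2 * (K + 1)))"
  have d2: "d2 > 0"
    using R e K by (simp add: d2_def)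
  show "\<exists>d>0. \<forall>x'\<in>A \<times> B. dist x' p < d \<longrightarrow> dist (case x' of (z, w) \<Rightarrow> F z w) (case p of (z, w) \<Rightarrow> F z w) < e"
  proof (intro exI[of _ "min d1 d2"] conjI ballI impI)
    fix x' assume x': "x' \<in> A \<times> B" "dist x' p < min d1 d2"
    obtain z w where zw: "x' = (z, w)" "z \<in> A" "w \<in> B"
      using x' by blast
    have "dist z z0 < d2" "dist w w0 < d1"
      using x' dist_fst_le[of x' p] dist_snd_le[of x' p] zw zw0 by auto
    then have "z \<in> ball z0 R" "norm (z - z0) \<le> d2"
      by (auto simp: d2_def dist_norm norm_minus_commute)
    then have "norm (F z w - F z0 w) \<le> K / R * d2"
      using R K zw by (intro order_trans[OF lip mult_left_mono]) auto
    also have "\<dots> \<le> K / R * (e * R / (2 * (K + 1)))"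
      using R K by (intro mult_left_mono) (auto simp: d2_def)
    also have "\<dots> = e / 2 * (K / (K + 1))"
      using R by simp
    also have "\<dots> \<le> e / 2 * 1"
      using K e by (intro mult_left_mono) auto
    finally have "norm (F z w - F z0 w) \<le> e / 2"
      by simp
    then have "dist (F z w) (F z0 w0) < e"
      using d1(2)[OF zw(3) \<open>dist w w0 < d1\<close>] dist_triangle[of "F z w" "F z0 w0" "F z0 w"]
      by (simp add: dist_norm)
    then show "dist (case x' of (z, w) \<Rightarrow> F z w) (case p of (z, w) \<Rightarrow> F z w) < e"
      by (simp add: zw zw0)
  qed (use d1 d2 in auto)
qed

text \<open>
  Cauchy's formula in the first variable, evaluated at the second, writes \<open>F z z\<close> as a contour integral
  of \<open>F \<zeta> z / (\<zeta> - z)\<close>. Here \<open>z\<close> occurs only in the second argument of \<open>F\<close>, in which \<open>F\<close> is analytic.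
\<close>

lemma holomorphic_on_diagonal:
  assumes D: "open D" and cont: "continuous_on (D \<times> D) (\<lambda>(z, w). F z w)"
    and hol1: "\<And>w. w \<in> D \<Longrightarrow> (\<lambda>z. F z w) holomorphic_on D"
    and hol2: "\<And>z. z \<in> D \<Longrightarrow> F z holomorphic_on D"
  shows "(\<lambda>z. F z z) holomorphic_on D"
proof -
  have "\<exists>r>0. (\<lambda>z. F z z) holomorphic_on ball z0 r" if z0: "z0 \<in> D" for z0
  proof -
    obtain r where r: "r > 0" "cball z0 r \<subseteq> D"
      using D z0 open_contains_cball by blast
    have im: "path_image (circlepath z0 r) \<subseteq> D" "ball z0 r \<subseteq> D"
      using r by auto
    have "(\<lambda>z. contour_integral (circlepath z0 r) (\<lambda>\<zeta>. F \<zeta> z / (\<zeta> - z))) holomorphic_on ball z0 r"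
    proof (rule holomorphic_on_contour_integral_param)
      have "continuous_on (ball z0 r \<times> path_image (circlepath z0 r)) (\<lambda>p. F (snd p) (fst p))"
      proof -
        have "continuous_on (ball z0 r \<times> path_image (circlepath z0 r))
            (\<lambda>p. case (snd p, fst p) of (z, w) \<Rightarrow> F z w)"
        proof (rule continuous_on_compose2[OF cont])
          show "(\<lambda>p. (snd p, fst p)) ` (ball z0 r \<times> path_image (circlepath z0 r)) \<subseteq> D \<times> D"
          proof (rule image_subsetI)
            fix p assume "p \<in> ball z0 r \<times> path_image (circlepath z0 r)"
            then show "(snd p, fst p) \<in> D \<times> D"
              using im by (simp only: mem_Times_iff fst_conv snd_conv) (blast dest: subsetD)
          qed
        qed (intro continuous_intros)
        then show ?thesis by simp
      qed
      then show "continuous_on (ball z0 r \<times> path_image (circlepath z0 r)) (\<lambda>(z, \<zeta>). F \<zeta> z / (\<zeta> - z))"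
        unfolding split_def using r(1) by (intro continuous_intros) (auto simp: dist_commute)
      show "(\<lambda>z. F w z / (w - z)) holomorphic_on ball z0 r" if "w \<in> path_image (circlepath z0 r)" for w
        using that im r(1) by (intro holomorphic_intros holomorphic_on_subset[OF hol2]) auto
      show "continuous_on {0..1} (\<lambda>t. vector_derivative (circlepath z0 r) (at t))"
        unfolding vector_derivative_circlepath by (intro continuous_intros)
    qed auto
    then have "(\<lambda>z. contour_integral (circlepath z0 r) (\<lambda>\<zeta>. F \<zeta> z / (\<zeta> - z)) / (2 * of_real pi * \<i>)) holomorphic_on ball z0 r"
      by (intro holomorphic_intros) auto
    moreover have "contour_integral (circlepath z0 r) (\<lambda>\<zeta>. F \<zeta> z / (\<zeta> - z)) / (2 * of_real pi * \<i>) = F z z"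
      if "z \<in> ball z0 r" for z
    proof -
      have "((\<lambda>\<zeta>. F \<zeta> z / (\<zeta> - z)) has_contour_integral 2 * of_real pi * \<i> * F z z) (circlepath z0 r)"
        using that im r by (intro Cauchy_integral_circlepath_simple holomorphic_on_subset[OF hol1])
          (auto simp: dist_norm norm_minus_commute)
      then show ?thesis
        using contour_integral_unique by fastforce
    qed
    ultimately have "(\<lambda>z. F z z) holomorphic_on ball z0 r"
      by (rule holomorphic_transform)
    then show ?thesis
      using r(1) by blast
  qed
  then show ?thesis
    using D by (metis analytic_on_def analytic_imp_holomorphic)
qed

section \<open>Integrals along segments from a boundary point\<close>

definition contains_rays :: "complex \<Rightarrow> complex set \<Rightarrow> bool" where
  "contains_rays c D \<longleftrightarrow> c \<notin> D \<and> (\<forall>z\<in>D. \<forall>t\<in>{0<..1}. linepath c z t \<in> D)"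

lemma norm_linepath_diff: "0 \<le> t \<Longrightarrow> norm (linepath c z t - c) = t * norm (z - c)"
proof -
  assume "0 \<le> t"
  moreover have "linepath c z t - c = t *\<^sub>R (z - c)"
    by (simp add: linepath_def algebra_simps)
  ultimately show ?thesis by simp
qed

text \<open>
  \<open>Q\<close> is a primitive of \<open>q\<close> on the half-line in the sense needed for the fundamental theorem of
  calculus: singularities of \<open>q\<close> at \<open>0\<close> and \<open>L\<close> are harmless as long as \<open>Q\<close> is continuous.
\<close>

definition antiderivative_off :: "real \<Rightarrow> (real \<Rightarrow> real) \<Rightarrow> (real \<Rightarrow> real) \<Rightarrow> bool" where
  "antiderivative_off L Q q \<longleftrightarrow> continuous_on {0..} Q \<and>
     (\<forall>s>0. s \<noteq> L \<longrightarrow> (Q has_real_derivative q s) (at s))"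

lemma antiderivative_off_scaled:
  assumes Q: "antiderivative_off L Q q" and r: "0 < r" and e: "0 \<le> e"
  shows "((\<lambda>t. q (t * r) * r) has_integral (Q (e * r) - Q 0)) {0..e}"
proof -
  have "((\<lambda>t. q (t * r) * r) has_integral (Q (e * r) - Q (0 * r))) {0..e}"
  proof (rule fundamental_theorem_of_calculus_interior_strong[of "{L / r}"])
    fix t assume t: "t \<in> {0<..<e} - {L / r}"
    then have "t * r > 0" "t * r \<noteq> L"
      using r by auto
    then have "(Q has_real_derivative q (t * r)) (at (t * r))"
      using Q by (simp add: antiderivative_off_def)
    moreover have "((\<lambda>t. t * r) has_real_derivative r) (at t)"
      by (auto intro!: derivative_eq_intros)
    ultimately have "((\<lambda>t. Q (t * r)) has_real_derivative q (t * r) * r) (at t)"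
      by (rule DERIV_chain2)
    then show "((\<lambda>t. Q (t * r)) has_vector_derivative q (t * r) * r) (at t)"
      unfolding has_real_derivative_iff_has_vector_derivative .
  next
    show "continuous_on {0..e} (\<lambda>t. Q (t * r))"
    proof (rule continuous_on_compose2[of "{0..}" Q])
      show "continuous_on {0..} Q"
        using Q by (simp add: antiderivative_off_def)
    qed (use r in \<open>auto intro!: continuous_intros\<close>)
  qed (use e in auto)
  then show ?thesis by simp
qed

text \<open>
  The truncated range \<open>{0..e}\<close> is used to cut off the singularity at the initial point \<open>c\<close>. A segment
  from \<open>c\<close> meets the circle of radius \<open>L\<close> at most once, so that circle costs one exceptional parameter.
\<close>

lemma ray_integral:
  assumes D: "contains_rays c D" and Q: "antiderivative_off L Q q"
    and G: "continuous_on D G"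
    and le: "\<And>w. w \<in> D \<Longrightarrow> norm (w - c) \<noteq> L \<Longrightarrow> norm (G w) \<le> q (norm (w - c))"
    and z: "z \<in> D" and e: "0 \<le> e" "e \<le> 1"
  shows "(\<lambda>t. G (linepath c z t) * (z - c)) integrable_on {0..e}"
    and "norm (integral {0..e} (\<lambda>t. G (linepath c z t) * (z - c))) \<le> Q (e * norm (z - c)) - Q 0"
proof -
  define r where "r = norm (z - c)"
  have r: "r > 0"
    using D z by (auto simp: r_def contains_rays_def)
  have mem: "linepath c z t \<in> D" if "t \<in> {0<..<e}" for t
    using D z e that by (auto simp: contains_rays_def)
  have I: "((\<lambda>t. q (t * r) * r) has_integral (Q (e * r) - Q 0)) {0..e}"
    by (rule antiderivative_off_scaled[OF Q r e(1)])
  have bd: "norm (G (linepath c z t) * (z - c)) \<le> q (t * r) * r" if "t \<in> {0<..<e} - {L / r}" for t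
  proof -
    have "norm (linepath c z t - c) = t * r"
      using that by (simp add: norm_linepath_diff r_def)
    moreover have "t * r \<noteq> L"
      using that r by auto
    ultimately have "norm (G (linepath c z t)) \<le> q (t * r)"
      using le[OF mem, of t] that by simp
    then show ?thesis
      using r by (simp add: norm_mult r_def)
  qed
  show int: "(\<lambda>t. G (linepath c z t) * (z - c)) integrable_on {0..e}"
  proof (rule dominated_integrable_Icc[where N = "{L / r}", OF _ I _ bd])
    show "continuous_on {0<..<e} (\<lambda>t. G (linepath c z t) * (z - c))"
      using mem by (intro continuous_intros continuous_on_compose2[OF G]) auto
  qed auto
  have "norm (integral {0..e} (\<lambda>t. G (linepath c z t) * (z - c))) \<le> Q (e * r) - Q 0"
    by (rule has_integral_norm_bound[where N = "{L / r}", OF integrable_integral[OF int] I _ bd]) auto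
  then show "norm (integral {0..e} (\<lambda>t. G (linepath c z t) * (z - c))) \<le> Q (e * norm (z - c)) - Q 0"
    by (simp add: r_def)
qed

lemma contour_integral_ray:
  assumes D: "contains_rays c D" and Q: "antiderivative_off L Q q"
    and G: "continuous_on D G"
    and le: "\<And>w. w \<in> D \<Longrightarrow> norm (w - c) \<noteq> L \<Longrightarrow> norm (G w) \<le> q (norm (w - c))"
    and z: "z \<in> D"
  shows "G contour_integrable_on linepath c z"
    and "norm (contour_integral (linepath c z) G) \<le> Q (norm (z - c)) - Q 0"
proof -
  note * = ray_integral[OF D Q G le z, of 1]
  show int: "G contour_integrable_on linepath c z"
    using *(1) by (simp add: contour_integrable_on_def has_contour_integral_linepath integrable_on_def)
  have "contour_integral (linepath c z) G = integral {0..1} (\<lambda>t. G (linepath c z t) * (z - c))"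
    using has_contour_integral_integral[OF int]
    unfolding has_contour_integral_linepath by (rule integral_unique[symmetric])
  then show "norm (contour_integral (linepath c z) G) \<le> Q (norm (z - c)) - Q 0"
    using *(2) by simp
qed

text \<open>
  For a fixed parameter \<open>\<tau>\<close> the integrand \<open>G z (c + \<tau> * (z - c)) * (z - c)\<close> is analytic in \<open>z\<close>: it is the
  diagonal of a separately analytic function. Over the parameters in \<open>[\<epsilon>, 1]\<close> it is jointly continuous,
  and the integral over the remaining \<open>[0, \<epsilon>]\<close> is at most
  \<open>Q (\<epsilon> * norm (z - c)) - Q 0\<close>, which tends to zero uniformly in \<open>z\<close> because \<open>D\<close> is bounded.
\<close>

lemma holomorphic_on_ray_integral:
  assumes oD: "open D" and D: "contains_rays c D" and bdd: "\<And>z. z \<in> D \<Longrightarrow> norm (z - c) \<le> M"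
    and Q: "antiderivative_off L Q q"
    and cont: "continuous_on (D \<times> D) (\<lambda>(z, w). G z w)"
    and hol1: "\<And>w. w \<in> D \<Longrightarrow> (\<lambda>z. G z w) holomorphic_on D"
    and hol2: "\<And>z. z \<in> D \<Longrightarrow> G z holomorphic_on D"
    and le: "\<And>z w. z \<in> D \<Longrightarrow> w \<in> D \<Longrightarrow> norm (w - c) \<noteq> L \<Longrightarrow> norm (G z w) \<le> q (norm (w - c))"
  shows "(\<lambda>z. contour_integral (linepath c z) (G z)) holomorphic_on D"
proof -
  define \<epsilon> where "\<epsilon> n = 1 / (real n + 2)" for n
  have \<epsilon>: "0 < \<epsilon> n" "\<epsilon> n < 1" for n
    by (simp_all add: \<epsilon>_def)
  have \<epsilon>_lim: "\<epsilon> \<longlonglongrightarrow> 0"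
    unfolding \<epsilon>_def by real_asymp
  define V where "V z = contour_integral (linepath c z) (G z)" for z
  \<comment> \<open>Writing the parameter integral as a contour integral along a real segment makes Morera's argument applicable.\<close>
  define Vn where "Vn n z = contour_integral (linepath (of_real (\<epsilon> n)) 1)
      (\<lambda>\<tau>. G z (c + \<tau> * (z - c)) * (z - c))" for n z
  have lin: "linepath c z t = c + of_real t * (z - c)" for z t
    by (simp add: linepath_def scaleR_conv_of_real algebra_simps)
  have mem: "c + \<tau> * (z - c) \<in> D" if "z \<in> D" "\<tau> \<in> closed_segment (of_real (\<epsilon> n)) 1" for z \<tau> n
  proof -
    have "\<tau> \<in> of_real ` closed_segment (\<epsilon> n) 1"
    proof -
      have "closed_segment (of_real (\<epsilon> n)) (of_real 1 :: complex) = of_real ` closed_segment (\<epsilon> n) 1"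
        by (rule closed_segment_of_real)
      then show ?thesis
        using that(2) by simp
    qed
    then obtain t where "\<tau> = of_real t" "\<epsilon> n \<le> t" "t \<le> 1"
      using \<epsilon>[of n] by (auto simp: closed_segment_eq_real_ivl)
    then show ?thesis
      using D that(1) \<epsilon>(1)[of n] lin[of z t] unfolding contains_rays_def
      by (metis greaterThanAtMost_iff less_le_trans)
  qed
  have hol: "Vn n holomorphic_on D" for n
    unfolding Vn_def[abs_def]
  proof (rule holomorphic_on_contour_integral_param[OF oD])
    let ?h = "linepath (of_real (\<epsilon> n)) 1 :: real \<Rightarrow> complex"
    have "continuous_on (D \<times> path_image ?h) (\<lambda>p. case (fst p, c + snd p * (fst p - c)) of (z, w) \<Rightarrow> G z w)"
      by (rule continuous_on_compose2[OF cont]) (use mem in \<open>auto intro!: continuous_intros\<close>)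
    then show "continuous_on (D \<times> path_image ?h) (\<lambda>(z, \<tau>). G z (c + \<tau> * (z - c)) * (z - c))"
      unfolding split_def by (intro continuous_intros) simp_all
    show "(\<lambda>z. G z (c + \<tau> * (z - c)) * (z - c)) holomorphic_on D" if \<tau>: "\<tau> \<in> path_image ?h" for \<tau>
    proof -
      have \<tau>': "c + \<tau> * (z - c) \<in> D" if "z \<in> D" for z
        using mem that \<tau> by simp
      have "(\<lambda>z. G z (c + \<tau> * (z - c))) holomorphic_on D"
      proof (rule holomorphic_on_diagonal[OF oD, of "\<lambda>z w. G z (c + \<tau> * (w - c))"])
        have "continuous_on (D \<times> D) (\<lambda>p. case (fst p, c + \<tau> * (snd p - c)) of (z, w) \<Rightarrow> G z w)"
        proof (rule continuous_on_compose2[OF cont])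
          show "(\<lambda>p. (fst p, c + \<tau> * (snd p - c))) ` (D \<times> D) \<subseteq> D \<times> D"
          proof (rule image_subsetI)
            fix p assume "p \<in> D \<times> D"
            then show "(fst p, c + \<tau> * (snd p - c)) \<in> D \<times> D"
              using \<tau>'[of "snd p"] by (simp add: mem_Times_iff)
          qed
        qed (intro continuous_intros)
        then show "continuous_on (D \<times> D) (\<lambda>(z, w). G z (c + \<tau> * (w - c)))"
          by (simp add: split_def)
        show "(\<lambda>w. G z (c + \<tau> * (w - c))) holomorphic_on D" if "z \<in> D" for z
          by (rule holomorphic_on_compose_gen[OF _ hol2[OF that], unfolded o_def])
            (use \<tau>' in \<open>auto intro!: holomorphic_intros\<close>)
      qed (use \<tau>' hol1 in auto)
      then show ?thesis
        by (intro holomorphic_intros)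
    qed
  qed auto
  have Vn_eq: "Vn n z = integral {\<epsilon> n..1} (\<lambda>t. G z (linepath c z t) * (z - c))" for n z
    unfolding Vn_def using \<epsilon>[of n] by (subst contour_integral_linepath_Reals_eq) (auto simp: lin)
  have Gc: "continuous_on D (G z)" if "z \<in> D" for z
    using hol2[OF that] by (rule holomorphic_on_imp_continuous_on)
  have diff: "norm (V z - Vn n z) \<le> Q (\<epsilon> n * norm (z - c)) - Q 0" if z: "z \<in> D" for n z
  proof -
    let ?f = "\<lambda>t. G z (linepath c z t) * (z - c)"
    note * = ray_integral[OF D Q Gc[OF z] le[OF z] z]
    have "V z = integral {0..1} ?f"
      by (simp add: V_def contour_integral_integral)
    also have "\<dots> = integral {0..\<epsilon> n} ?f + integral {\<epsilon> n..1} ?f"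
      using \<epsilon>[of n] by (intro Henstock_Kurzweil_Integration.integral_combine[symmetric] *(1)) auto
    finally have "V z - Vn n z = integral {0..\<epsilon> n} ?f"
      by (simp add: Vn_eq)
    then show ?thesis
      using *(2)[of "\<epsilon> n"] \<epsilon>[of n] by simp
  qed
  have unif: "uniform_limit D Vn V sequentially"
    unfolding uniform_limit_iff
  proof (intro allI impI)
    fix e :: real assume e: "e > 0"
    have "continuous_on {0..} Q"
      using Q by (simp add: antiderivative_off_def)
    then obtain \<delta> where \<delta>: "\<delta> > 0" "\<And>s. s \<ge> 0 \<Longrightarrow> dist s 0 < \<delta> \<Longrightarrow> dist (Q s) (Q 0) < e"
      using e unfolding continuous_on_iff by (metis atLeast_iff order_refl)
    have "(\<lambda>n. \<epsilon> n * \<bar>M\<bar>) \<longlonglongrightarrow> 0 * \<bar>M\<bar>"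
      by (intro tendsto_intros \<epsilon>_lim)
    then have "\<forall>\<^sub>F n in sequentially. \<epsilon> n * \<bar>M\<bar> < \<delta>"
      using \<delta>(1) by (intro order_tendstoD) auto
    then show "\<forall>\<^sub>F n in sequentially. \<forall>z\<in>D. dist (Vn n z) (V z) < e"
    proof (eventually_elim, intro ballI)
      fix n z assume n: "\<epsilon> n * \<bar>M\<bar> < \<delta>" and z: "z \<in> D"
      have "\<epsilon> n * norm (z - c) \<le> \<epsilon> n * \<bar>M\<bar>"
        using bdd[OF z] \<epsilon>(1)[of n] by (intro mult_left_mono) auto
      then have "\<epsilon> n * norm (z - c) < \<delta>"
        using n by linarith
      then have "dist (Q (\<epsilon> n * norm (z - c))) (Q 0) < e"
        using \<epsilon>(1)[of n] by (intro \<delta>(2)) auto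
      then show "dist (Vn n z) (V z) < e"
        using diff[OF z, of n] by (simp add: dist_norm norm_minus_commute)
    qed
  qed
  have "V holomorphic_on D"
  proof (rule holomorphic_uniform_sequence[OF oD hol])
    fix x assume "x \<in> D"
    then obtain d where "d > 0" "cball x d \<subseteq> D"
      using oD open_contains_cball by blast
    then show "\<exists>d>0. cball x d \<subseteq> D \<and> uniform_limit (cball x d) Vn V sequentially"
      using uniform_limit_on_subset[OF unif] by blast
  qed
  then show ?thesis
    by (simp add: V_def[abs_def])
qed

section \<open>The Neumann series on the complex domain\<close>

text \<open>
  One radial function \<open>q\<close>, into which all constants are absorbed, bounds both coefficients. The circle
  of radius \<open>L\<close> about \<open>a\<close> is where \<open>q\<close> may be singular.
\<close>

locale volterra_equation =
  fixes a :: real and D :: "complex set" and L M :: real and Q q :: "real \<Rightarrow> real"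
    and \<mu> :: "complex \<Rightarrow> complex" and k :: "complex \<Rightarrow> complex \<Rightarrow> complex"
  assumes open_D: "open D" and star: "contains_rays (of_real a) D"
    and bounded_D: "\<And>z. z \<in> D \<Longrightarrow> norm (z - of_real a) \<le> M"
    and Q: "antiderivative_off L Q q" and Q_0: "Q 0 = 0" and q_nonneg: "\<And>s. 0 \<le> q s"
    and \<mu>_hol: "\<mu> holomorphic_on D"
    and \<mu>_le: "\<And>w. w \<in> D \<Longrightarrow> norm (w - of_real a) \<noteq> L \<Longrightarrow> norm (\<mu> w) \<le> q (norm (w - of_real a))"
    and k_cont: "continuous_on (D \<times> D) (\<lambda>(z, w). k z w)"
    and k_hol1: "\<And>w. w \<in> D \<Longrightarrow> (\<lambda>z. k z w) holomorphic_on D"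
    and k_hol2: "\<And>z. z \<in> D \<Longrightarrow> k z holomorphic_on D"
    and k_le: "\<And>z w. z \<in> D \<Longrightarrow> w \<in> D \<Longrightarrow> norm (w - of_real a) \<noteq> L \<Longrightarrow>
      norm (k z w) \<le> q (norm (w - of_real a))"
begin

text \<open>
  The weight \<open>W = weight\<close> satisfies \<open>W' = 2 * (q + 1) * W\<close>. Hence a bound \<open>C * W\<close>, after multiplication
  by \<open>q + 1\<close> and integration, comes back as at most \<open>C / 2 * W\<close>.
\<close>

definition weight :: "real \<Rightarrow> real" where "weight s = exp (2 * (Q s + s))"

lemma weight_pos: "0 < weight s"
  by (simp add: weight_def)

lemma antiderivative_weight: "antiderivative_off L (\<lambda>s. C / 2 * weight s) (\<lambda>s. C * ((q s + 1) * weight s))"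
  unfolding antiderivative_off_def
proof (intro conjI allI impI)
  have c: "continuous_on {0..} Q"
    using Q by (simp add: antiderivative_off_def)
  show "continuous_on {0..} (\<lambda>s. C / 2 * weight s)"
    unfolding weight_def by (intro continuous_intros c)
  fix s :: real assume "s > 0" "s \<noteq> L"
  then have "(Q has_real_derivative q s) (at s)"
    using Q by (simp add: antiderivative_off_def)
  then show "((\<lambda>s. C / 2 * weight s) has_real_derivative C * ((q s + 1) * weight s)) (at s)"
    unfolding weight_def by (auto intro!: derivative_eq_intros)
qed

lemma bounded_on_D:
  assumes "continuous_on {0..} (f :: real \<Rightarrow> real)"
  obtains B where "B > 0" "\<And>z. z \<in> D \<Longrightarrow> f (norm (z - of_real a)) \<le> B"
proof -
  have "bounded (f ` {0..M})"
    by (intro compact_imp_bounded compact_continuous_image continuous_on_subset[OF assms]) auto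
  then obtain B where B: "\<And>s. s \<in> {0..M} \<Longrightarrow> norm (f s) \<le> B"
    unfolding bounded_iff by blast
  show ?thesis
  proof (rule that[of "max B 1"])
    fix z assume "z \<in> D"
    then show "f (norm (z - of_real a)) \<le> max B 1"
      using B[of "norm (z - of_real a)"] bounded_D by fastforce
  qed auto
qed

lemma weight_bounded: obtains B where "B > 0" "\<And>z. z \<in> D \<Longrightarrow> weight (norm (z - of_real a)) \<le> B"
proof -
  have "continuous_on {0..} weight"
    using antiderivative_weight[of 2] by (simp add: antiderivative_off_def)
  then show ?thesis
    by (rule bounded_on_D[of weight]) (rule that)
qed

lemma weighted_bound_imp_bounded:
  assumes "\<And>w. w \<in> D \<Longrightarrow> norm (U w) \<le> C * weight (norm (w - of_real a))" "0 \<le> C"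
  obtains B where "B > 0" "\<And>w. w \<in> D \<Longrightarrow> norm (U w :: complex) \<le> B"
proof (rule weight_bounded)
  fix B assume B: "B > 0" "\<And>z. z \<in> D \<Longrightarrow> weight (norm (z - of_real a)) \<le> B"
  show ?thesis
  proof (rule that[of "(C + 1) * B"])
    fix w assume w: "w \<in> D"
    have "C * weight (norm (w - of_real a)) \<le> (C + 1) * B"
      using B(2)[OF w] assms(2) weight_pos[of "norm (w - of_real a)"] by (intro mult_mono) auto
    then show "norm (U w) \<le> (C + 1) * B"
      using assms(1)[OF w] by linarith
  qed (use B assms in auto)
qed

text \<open>
  Halving already for the inner integral lets the summand \<open>1\<close> in \<open>q + 1\<close> absorb it when the operator
  integrates once more.
\<close>

lemma volterra_weighted:
  assumes U: "U holomorphic_on D" and le: "\<And>w. w \<in> D \<Longrightarrow> norm (U w) \<le> C * weight (norm (w - of_real a))"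
    and C: "0 \<le> C"
  shows "z \<in> D \<Longrightarrow> (\<lambda>w. k z w * U w) contour_integrable_on linepath (of_real a) z"
    and "z \<in> D \<Longrightarrow> norm (volterra k a U z) \<le> C / 2 * weight (norm (z - of_real a))"
    and "volterra k a U holomorphic_on D"
proof -
  have weight_0_nonneg: "0 \<le> C / 2 * weight 0"
    using C weight_pos[of 0] by simp
  have bd: "norm (k z w * U w) \<le> C * ((q (norm (w - of_real a)) + 1) * weight (norm (w - of_real a)))"
    if "z \<in> D" "w \<in> D" "norm (w - of_real a) \<noteq> L" for z w
  proof -
    have "norm (k z w * U w) \<le> (q (norm (w - of_real a)) + 1) * (C * weight (norm (w - of_real a)))"
      unfolding norm_mult using k_le[OF that] le[OF that(2)] q_nonneg[of "norm (w - of_real a)"]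
      by (intro mult_mono) auto
    then show ?thesis by (simp add: mult_ac)
  qed
  have hol2: "(\<lambda>w. k z w * U w) holomorphic_on D" if "z \<in> D" for z
    using k_hol2[OF that] U by (intro holomorphic_intros)
  show "(\<lambda>w. k z w * U w) contour_integrable_on linepath (of_real a) z" if "z \<in> D"
    by (rule contour_integral_ray(1)[OF star antiderivative_weight holomorphic_on_imp_continuous_on[OF hol2[OF that]] bd[OF that] that])
  show "norm (volterra k a U z) \<le> C / 2 * weight (norm (z - of_real a))" if "z \<in> D"
    using contour_integral_ray(2)[OF star antiderivative_weight holomorphic_on_imp_continuous_on[OF hol2[OF that]] bd[OF that] that]
      weight_0_nonneg unfolding volterra_def by linarith
  have cont: "continuous_on (D \<times> D) (\<lambda>(z, w). k z w * U w)"
    using k_cont unfolding split_def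
    by (intro continuous_intros continuous_on_compose2[OF holomorphic_on_imp_continuous_on[OF U]]) auto
  show "volterra k a U holomorphic_on D"
    unfolding volterra_def[abs_def]
  proof (rule holomorphic_on_ray_integral[OF open_D star bounded_D antiderivative_weight cont])
    show "(\<lambda>z. k z w * U w) holomorphic_on D" if "w \<in> D" for w
      using k_hol1[OF that] by (intro holomorphic_intros)
  qed (use hol2 bd in auto)
qed

definition volterra_op :: "(complex \<Rightarrow> complex) \<Rightarrow> complex \<Rightarrow> complex" where
  "volterra_op U z = contour_integral (linepath (of_real a) z) (\<lambda>w. \<mu> w * U w + volterra k a U w)"

lemma ray_primitive_holomorphic:
  assumes h: "h holomorphic_on D" and QQ: "antiderivative_off L QQ qq"
    and le: "\<And>w. w \<in> D \<Longrightarrow> norm (w - of_real a) \<noteq> L \<Longrightarrow> norm (h w) \<le> qq (norm (w - of_real a))"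
  shows "(\<lambda>z. contour_integral (linepath (of_real a) z) h) holomorphic_on D"
proof -
  have "continuous_on (D \<times> D) (\<lambda>p. h (snd p))"
    by (rule continuous_on_compose2[OF holomorphic_on_imp_continuous_on[OF h] continuous_on_snd[OF continuous_on_id]]) auto
  then show ?thesis
    using holomorphic_on_ray_integral[OF open_D star bounded_D QQ, of "\<lambda>_. h"] h le
    by (simp add: split_def)
qed

text \<open>
  The term \<open>\<mu> * U\<close> is bounded by \<open>q * C * weight\<close> and the inner integral by \<open>C * weight\<close>; together they
  are at most half the derivative of \<open>C * weight\<close>.
\<close>

lemma volterra_op_weighted:
  assumes U: "U holomorphic_on D" and le: "\<And>w. w \<in> D \<Longrightarrow> norm (U w) \<le> C * weight (norm (w - of_real a))"
    and C: "0 \<le> C"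
  shows "z \<in> D \<Longrightarrow> (\<lambda>w. \<mu> w * U w + volterra k a U w) contour_integrable_on linepath (of_real a) z"
    and "z \<in> D \<Longrightarrow> norm (volterra_op U z) \<le> C / 2 * weight (norm (z - of_real a))"
    and "volterra_op U holomorphic_on D"
proof -
  note V = volterra_weighted[OF U le C]
  have weight_0_nonneg: "0 \<le> C / 2 * weight 0"
    using C weight_pos[of 0] by simp
  have bd: "norm (\<mu> w * U w + volterra k a U w) \<le> C * ((q (norm (w - of_real a)) + 1) * weight (norm (w - of_real a)))"
    if "w \<in> D" "norm (w - of_real a) \<noteq> L" for w
  proof -
    let ?s = "norm (w - of_real a)"
    have "norm (\<mu> w * U w) \<le> q ?s * (C * weight ?s)"
      unfolding norm_mult using \<mu>_le[OF that] le[OF that(1)] q_nonneg[of ?s] by (intro mult_mono) auto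
    moreover have "norm (volterra k a U w) \<le> C * weight ?s"
    proof -
      have "C / 2 * weight ?s \<le> C * weight ?s"
        using C weight_pos[of ?s] by (intro mult_right_mono) auto
      then show ?thesis
        using V(2)[of w] that(1) by linarith
    qed
    ultimately show ?thesis
      using norm_triangle_ineq[of "\<mu> w * U w" "volterra k a U w"] by (simp add: algebra_simps)
  qed
  have hol: "(\<lambda>w. \<mu> w * U w + volterra k a U w) holomorphic_on D"
    using V(3) U \<mu>_hol by (intro holomorphic_intros)
  note cont = holomorphic_on_imp_continuous_on[OF hol]
  show "(\<lambda>w. \<mu> w * U w + volterra k a U w) contour_integrable_on linepath (of_real a) z" if "z \<in> D"
    by (rule contour_integral_ray(1)[OF star antiderivative_weight cont bd that])
  show "norm (volterra_op U z) \<le> C / 2 * weight (norm (z - of_real a))" if "z \<in> D"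
    using contour_integral_ray(2)[OF star antiderivative_weight cont bd that] weight_0_nonneg
    unfolding volterra_op_def by linarith
  show "volterra_op U holomorphic_on D"
    unfolding volterra_op_def[abs_def] by (rule ray_primitive_holomorphic[OF hol antiderivative_weight bd])
qed

lemma volterra_op_funpow:
  assumes "U holomorphic_on D" "\<And>w. w \<in> D \<Longrightarrow> norm (U w) \<le> C * weight (norm (w - of_real a))" "0 \<le> C"
  shows "(volterra_op ^^ n) U holomorphic_on D \<and> (\<forall>w\<in>D. norm ((volterra_op ^^ n) U w) \<le> C / 2 ^ n * weight (norm (w - of_real a)))"
proof (induction n)
  case (Suc n)
  then have "(volterra_op ^^ n) U holomorphic_on D"
    "\<And>w. w \<in> D \<Longrightarrow> norm ((volterra_op ^^ n) U w) \<le> C / 2 ^ n * weight (norm (w - of_real a))"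
    by auto
  from volterra_op_weighted(2,3)[OF this] assms(3) show ?case
    by (simp add: mult.commute)
qed (use assms in auto)

lemma neumann_series:
  assumes U: "U holomorphic_on D" and le: "\<And>w. w \<in> D \<Longrightarrow> norm (U w) \<le> C * weight (norm (w - of_real a))"
    and C: "0 \<le> C"
  shows "(\<lambda>z. \<Sum>n. (volterra_op ^^ n) U z) holomorphic_on D"
    and "\<And>z. z \<in> D \<Longrightarrow> norm (\<Sum>n. (volterra_op ^^ n) U z) \<le> 2 * C * weight (norm (z - of_real a))"
proof -
  note iter = volterra_op_funpow[OF U le C]
  have geo: "(\<lambda>n. c / 2 ^ n) sums (2 * c)" for c :: real
  proof -
    have "(\<lambda>n. c * (1 / 2) ^ n) sums (c * (1 / (1 - 1 / 2)))"
      by (intro sums_mult geometric_sums) simp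
    then show ?thesis
      by (simp add: power_divide mult.commute)
  qed
  show "norm (\<Sum>n. (volterra_op ^^ n) U z) \<le> 2 * C * weight (norm (z - of_real a))" if "z \<in> D" for z
  proof -
    have "norm (\<Sum>n. (volterra_op ^^ n) U z) \<le> (\<Sum>n. (C * weight (norm (z - of_real a))) / 2 ^ n)"
    proof (rule norm_suminf_le)
      show "summable (\<lambda>n. (C * weight (norm (z - of_real a))) / 2 ^ n)"
        using geo sums_summable by blast
      show "norm ((volterra_op ^^ n) U z) \<le> (C * weight (norm (z - of_real a))) / 2 ^ n" for n
        using iter[of n] that by simp
    qed
    then show ?thesis
      using geo[of "C * weight (norm (z - of_real a))"] by (simp add: sums_iff)
  qed
  obtain B where B: "B > 0" "\<And>z. z \<in> D \<Longrightarrow> weight (norm (z - of_real a)) \<le> B"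
    by (rule weight_bounded) blast
  have unif: "uniform_limit D (\<lambda>n z. \<Sum>i<n. (volterra_op ^^ i) U z) (\<lambda>z. \<Sum>n. (volterra_op ^^ n) U z) sequentially"
  proof (rule Weierstrass_m_test)
    show "summable (\<lambda>n. (C * B) / 2 ^ n)"
      using geo sums_summable by blast
    show "norm ((volterra_op ^^ n) U z) \<le> (C * B) / 2 ^ n" if "z \<in> D" for n z
    proof -
      have "norm ((volterra_op ^^ n) U z) \<le> C / 2 ^ n * weight (norm (z - of_real a))"
        using iter[of n] that by blast
      also have "\<dots> \<le> C / 2 ^ n * B"
        using B(2)[OF that] C by (intro mult_left_mono) auto
      finally show ?thesis by simp
    qed
  qed
  show "(\<lambda>z. \<Sum>n. (volterra_op ^^ n) U z) holomorphic_on D"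
  proof (rule holomorphic_uniform_sequence[OF open_D])
    show "(\<lambda>z. \<Sum>i<n. (volterra_op ^^ i) U z) holomorphic_on D" for n
      using iter by (intro holomorphic_intros) auto
    fix x assume "x \<in> D"
    then obtain d where "d > 0" "cball x d \<subseteq> D"
      using open_D open_contains_cball by blast
    then show "\<exists>d>0. cball x d \<subseteq> D \<and>
        uniform_limit (cball x d) (\<lambda>n z. \<Sum>i<n. (volterra_op ^^ i) U z) (\<lambda>z. \<Sum>n. (volterra_op ^^ n) U z) sequentially"
      using uniform_limit_on_subset[OF unif] by blast
  qed
qed

end

section \<open>Agreement with the solution on the real interval\<close>

lemma antiderivative_off_shifted:
  assumes Q: "antiderivative_off L Q q" and t: "a \<le> t"
  shows "((\<lambda>s. q (s - a)) has_integral (Q (t - a) - Q 0)) {a..t}"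
proof -
  have "((\<lambda>s. q (s - a)) has_integral (Q (t - a) - Q (a - a))) {a..t}"
  proof (rule fundamental_theorem_of_calculus_interior_strong[of "{a + L}"])
    fix s assume s: "s \<in> {a<..<t} - {a + L}"
    then have "(Q has_real_derivative q (s - a)) (at (s - a))"
      using Q by (auto simp: antiderivative_off_def)
    moreover have "((\<lambda>s. s - a) has_real_derivative 1) (at s)"
      by (auto intro!: derivative_eq_intros)
    ultimately have "((\<lambda>s. Q (s - a)) has_real_derivative q (s - a) * 1) (at s)"
      by (rule DERIV_chain2)
    then show "((\<lambda>s. Q (s - a)) has_vector_derivative q (s - a)) (at s)"
      unfolding has_real_derivative_iff_has_vector_derivative by simp
  next
    show "continuous_on {a..t} (\<lambda>s. Q (s - a))"
    proof (rule continuous_on_compose2[of "{0..}" Q])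
      show "continuous_on {0..} Q"
        using Q by (simp add: antiderivative_off_def)
    qed (auto intro!: continuous_intros)
  qed (use t in auto)
  then show ?thesis by simp
qed

lemma has_integral_linepath_real:
  assumes "f contour_integrable_on linepath (of_real a) (of_real t)" "a < t"
  shows "((\<lambda>s. f (of_real s)) has_integral contour_integral (linepath (of_real a) (of_real t)) f) {a..t}"
  using has_contour_integral_integral[OF assms(1)] assms(2)
  by (subst (asm) has_contour_integral_linepath_Reals_iff) auto

lemma volterra_of_real:
  assumes "a \<le> s"
  shows "volterra k a U (of_real s) = volterra_real k a (\<lambda>r. U (of_real r)) s"
proof (cases "a = s")
  case True
  then show ?thesis
    by (simp add: volterra_def volterra_real_def)
next
  case False
  then show ?thesis
    using assms by (simp add: volterra_def volterra_real_def contour_integral_linepath_Reals_eq)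
qed

locale real_volterra_equation = volterra_equation +
  fixes b :: real
  assumes b: "b = a + L" "0 < L" and real_in_D: "\<And>t. a < t \<Longrightarrow> t < b \<Longrightarrow> of_real t \<in> D"
begin

text \<open>
  The operator on functions of a real variable, as a relation: it records that the integrals exist,
  which for a merely given solution is a hypothesis and not a consequence of regularity.
\<close>

definition real_op_maps :: "(real \<Rightarrow> complex) \<Rightarrow> (real \<Rightarrow> complex) \<Rightarrow> bool" where
  "real_op_maps v w \<longleftrightarrow>
     (\<forall>t\<in>{a<..<b}. (\<lambda>r. k (of_real t) (of_real r) * v r) integrable_on {a..t}) \<and>
     (\<forall>t\<in>{a<..<b}. ((\<lambda>s. \<mu> (of_real s) * v s + volterra_real k a v s) has_integral w t) {a..t})"

lemma real_op_maps_weighted: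
  assumes maps: "real_op_maps v w" and le: "\<And>t. a < t \<Longrightarrow> t < b \<Longrightarrow> norm (v t) \<le> C * weight (t - a)" and C: "0 \<le> C"
    and t: "a < t" "t < b"
  shows "norm (w t) \<le> C / 2 * weight (t - a)"
proof -
  have I: "((\<lambda>s. C * ((q (s - a) + 1) * weight (s - a))) has_integral (C / 2 * weight (s - a) - C / 2 * weight 0)) {a..s}"
    if "a \<le> s" for s
    by (rule antiderivative_off_shifted[OF antiderivative_weight that])
  have weight_0: "0 \<le> C / 2 * weight 0"
    using C weight_pos[of 0] by simp
  have in_D: "of_real r \<in> D" "norm (of_real r - of_real a :: complex) = r - a" "r - a \<noteq> L" if "r \<in> {a<..<b}" for r
    using that real_in_D b by (auto simp flip: of_real_diff)
  have V: "norm (volterra_real k a v s) \<le> C / 2 * weight (s - a)" if s: "s \<in> {a<..<b}" for s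
  proof -
    have "((\<lambda>r. k (of_real s) (of_real r) * v r) has_integral volterra_real k a v s) {a..s}"
      using maps s unfolding real_op_maps_def volterra_real_def by (simp add: has_integral_integral)
    then have "norm (volterra_real k a v s) \<le> C / 2 * weight (s - a) - C / 2 * weight 0"
    proof (rule has_integral_norm_bound[OF _ I, where N = "{}"])
      fix r assume r: "r \<in> {a<..<s} - {}"
      then have "norm (k (of_real s) (of_real r)) \<le> q (r - a)"
        using k_le[of "of_real s" "of_real r"] in_D[of r] in_D[of s] s by simp
      then have "norm (k (of_real s) (of_real r) * v r) \<le> (q (r - a) + 1) * (C * weight (r - a))"
        unfolding norm_mult using le[of r] r s q_nonneg[of "r - a"] by (intro mult_mono) auto
      then show "norm (k (of_real s) (of_real r) * v r) \<le> C * ((q (r - a) + 1) * weight (r - a))"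
        by (simp add: mult_ac)
    qed (use s in auto)
    then show ?thesis using weight_0 by linarith
  qed
  have "((\<lambda>s. \<mu> (of_real s) * v s + volterra_real k a v s) has_integral w t) {a..t}"
    using maps t by (simp add: real_op_maps_def)
  then have "norm (w t) \<le> C / 2 * weight (t - a) - C / 2 * weight 0"
  proof (rule has_integral_norm_bound[OF _ I, where N = "{}"])
    fix r assume r: "r \<in> {a<..<t} - {}"
    then have r': "r \<in> {a<..<b}" using t by auto
    have "norm (\<mu> (of_real r)) \<le> q (r - a)"
      using \<mu>_le[of "of_real r"] in_D[OF r'] by simp
    then have "norm (\<mu> (of_real r) * v r) \<le> q (r - a) * (C * weight (r - a))"
      unfolding norm_mult using le[of r] r' q_nonneg[of "r - a"] by (intro mult_mono) auto
    moreover have "C / 2 * weight (r - a) \<le> C * weight (r - a)"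
      using C weight_pos[of "r - a"] by (intro mult_right_mono) auto
    ultimately show "norm (\<mu> (of_real r) * v r + volterra_real k a v r) \<le> C * ((q (r - a) + 1) * weight (r - a))"
      using V[OF r'] norm_triangle_ineq[of "\<mu> (of_real r) * v r" "volterra_real k a v r"]
      by (simp add: algebra_simps)
  qed (use t in auto)
  then show ?thesis using weight_0 by linarith
qed

lemma volterra_op_on_reals:
  assumes U: "U holomorphic_on D" and le: "\<And>w. w \<in> D \<Longrightarrow> norm (U w) \<le> C * weight (norm (w - of_real a))"
    and C: "0 \<le> C"
  shows "real_op_maps (\<lambda>t. U (of_real t)) (\<lambda>t. volterra_op U (of_real t))"
  unfolding real_op_maps_def
proof (intro conjI ballI)
  fix t assume t: "t \<in> {a<..<b}"
  then have tD: "of_real t \<in> D"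
    using real_in_D by simp
  show "(\<lambda>r. k (of_real t) (of_real r) * U (of_real r)) integrable_on {a..t}"
    using has_integral_linepath_real[OF volterra_weighted(1)[OF U le C tD]] t by auto
  have "((\<lambda>s. \<mu> (of_real s) * U (of_real s) + volterra k a U (of_real s)) has_integral volterra_op U (of_real t)) {a..t}"
    using has_integral_linepath_real[OF volterra_op_weighted(1)[OF U le C tD]] t by (simp add: volterra_op_def)
  then show "((\<lambda>s. \<mu> (of_real s) * U (of_real s) + volterra_real k a (\<lambda>r. U (of_real r)) s)
      has_integral volterra_op U (of_real t)) {a..t}"
    by (rule has_integral_eq[rotated]) (simp add: volterra_of_real)
qed

lemma real_op_maps_diff:
  assumes "real_op_maps v w" "real_op_maps v' w'"
  shows "real_op_maps (\<lambda>t. v t - v' t) (\<lambda>t. w t - w' t)"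
  unfolding real_op_maps_def
proof (intro conjI ballI)
  fix t assume t: "t \<in> {a<..<b}"
  show "(\<lambda>r. k (of_real t) (of_real r) * (v r - v' r)) integrable_on {a..t}"
    using assms t unfolding real_op_maps_def right_diff_distrib by (intro integrable_diff) auto
  have V: "volterra_real k a (\<lambda>t. v t - v' t) s = volterra_real k a v s - volterra_real k a v' s"
    if "s \<in> {a..t}" for s
  proof (cases "s = a")
    case False
    then show ?thesis
      using assms t that unfolding real_op_maps_def volterra_real_def right_diff_distrib
      by (intro Henstock_Kurzweil_Integration.integral_diff) auto
  qed (simp add: volterra_real_def)
  have "((\<lambda>s. (\<mu> (of_real s) * v s + volterra_real k a v s) - (\<mu> (of_real s) * v' s + volterra_real k a v' s))
      has_integral w t - w' t) {a..t}"
    using assms t unfolding real_op_maps_def by (intro has_integral_diff) auto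
  then show "((\<lambda>s. \<mu> (of_real s) * (v s - v' s) + volterra_real k a (\<lambda>t. v t - v' t) s)
      has_integral w t - w' t) {a..t}"
    by (rule has_integral_eq[rotated]) (simp add: V algebra_simps)
qed

text \<open>
  The hypothesis on \<open>u\<close> says that \<open>u\<close> is a fixed point of \<open>v \<mapsto> U + T v\<close>, with \<open>T\<close> the integral operator.
  Subtracting the first \<open>n\<close> terms of the series from \<open>u\<close> leaves \<open>T\<close> applied \<open>n\<close> times to \<open>u\<close>, and each
  application halves the weighted bound.
\<close>

lemma real_solution_eq_neumann_series:
  assumes U: "U holomorphic_on D" and le: "\<And>w. w \<in> D \<Longrightarrow> norm (U w) \<le> C * weight (norm (w - of_real a))"
    and C: "0 \<le> C"
    and u: "real_op_maps u (\<lambda>t. u t - U (of_real t))"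
    and B: "\<And>t. a < t \<Longrightarrow> t < b \<Longrightarrow> norm (u t) \<le> B"
    and t: "a < t" "t < b"
  shows "u t = (\<Sum>n. (volterra_op ^^ n) U (of_real t))"
proof -
  \<comment> \<open>the error after n terms\<close>
  define e where "e n t = u t - (\<Sum>i<n. (volterra_op ^^ i) U (of_real t))" for n t
  have e_0: "e 0 = u"
    by (simp add: e_def fun_eq_iff)
  have e_Suc: "e (Suc n) = (\<lambda>t. e n t - (volterra_op ^^ n) U (of_real t))" for n
    by (simp add: e_def fun_eq_iff)
  note iter = volterra_op_funpow[OF U le C]
  have step: "real_op_maps (e n) (e (Suc n))" for n
  proof (induction n)
    case 0
    show ?case
      unfolding e_Suc unfolding e_0 using u by simp
  next
    case (Suc n)
    have "real_op_maps (\<lambda>t. (volterra_op ^^ n) U (of_real t)) (\<lambda>t. volterra_op ((volterra_op ^^ n) U) (of_real t))"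
      by (rule volterra_op_on_reals[of _ "C / 2 ^ n"]) (use iter[of n] C in auto)
    from real_op_maps_diff[OF Suc this] show ?case
      by (simp flip: e_Suc) (simp add: e_Suc)
  qed
  have "0 \<le> B"
    using B[OF t] norm_ge_zero[of "u t"] by linarith
  obtain c where c: "c > 0" "\<And>s. s \<in> {a..b} \<Longrightarrow> c \<le> weight (s - a)"
  proof -
    have "continuous_on {0..} weight"
      using antiderivative_weight[of 2] by (simp add: antiderivative_off_def)
    then have "continuous_on {a..b} (\<lambda>s. weight (s - a))"
      by (rule continuous_on_compose2) (auto intro!: continuous_intros)
    then obtain x where "x \<in> {a..b}" "\<And>s. s \<in> {a..b} \<Longrightarrow> weight (x - a) \<le> weight (s - a)"
      using continuous_attains_inf[of "{a..b}" "\<lambda>s. weight (s - a)"] b by auto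
    then show ?thesis using that weight_pos by blast
  qed
  have bound: "norm (e n t) \<le> (B / c) / 2 ^ n * weight (t - a)" if "a < t" "t < b" for n t
    using that
  proof (induction n arbitrary: t)
    case 0
    have "B = B / c * c"
      using c(1) by simp
    also have "\<dots> \<le> B / c * weight (t - a)"
      using c 0 \<open>0 \<le> B\<close> by (intro mult_left_mono) auto
    finally show ?case
      using B[OF 0] by (simp add: e_0)
  next
    case (Suc n)
    have "norm (e (Suc n) t) \<le> (B / c) / 2 ^ n / 2 * weight (t - a)"
      by (rule real_op_maps_weighted[OF step Suc.IH _ Suc.prems]) (use \<open>0 \<le> B\<close> c in auto)
    then show ?case
      by (simp add: mult.commute)
  qed
  have "(\<lambda>n. e n t) \<longlonglongrightarrow> 0"
  proof (rule Lim_null_comparison)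
    show "\<forall>\<^sub>F n in sequentially. norm (e n t) \<le> (B / c) / 2 ^ n * weight (t - a)"
      using bound[OF t] by simp
    show "(\<lambda>n. (B / c) / 2 ^ n * weight (t - a)) \<longlonglongrightarrow> 0"
      by (intro tendsto_mult_left_zero LIMSEQ_divide_realpow_zero) simp
  qed
  then have "(\<lambda>n. \<Sum>i<n. (volterra_op ^^ i) U (of_real t)) \<longlonglongrightarrow> u t"
    unfolding e_def using tendsto_diff[of "\<lambda>_. u t" "u t" sequentially "\<lambda>n. u t - (\<Sum>i<n. (volterra_op ^^ i) U (of_real t))" 0]
    by simp
  then show ?thesis
    using sums_def sums_unique by blast
qed

text \<open>
  The part of the right-hand side of the integrated equation that does not involve the solution; the
  Neumann series starts from it.
\<close>

definition initial_term :: "complex \<Rightarrow> (complex \<Rightarrow> complex) \<Rightarrow> complex \<Rightarrow> complex" where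
  "initial_term u\<^sub>a g z = u\<^sub>a + contour_integral (linepath (of_real a) z) g"

text \<open>
  The starting bound on \<open>u\<close> comes from its continuity on the closed interval, where it is an indefinite
  integral.
\<close>

lemma IVP_solution_extends:
  assumes g: "g holomorphic_on D"
    and g_le: "\<And>w. w \<in> D \<Longrightarrow> norm (w - of_real a) \<noteq> L \<Longrightarrow> norm (g w) \<le> q (norm (w - of_real a))"
    and u: "solves_IVP a b u\<^sub>a g \<mu> k u"
  obtains U C where "0 \<le> C" "U holomorphic_on D"
    "\<And>w. w \<in> D \<Longrightarrow> norm (U w) \<le> C * weight (norm (w - of_real a))"
    "\<And>t. a < t \<Longrightarrow> t < b \<Longrightarrow> U (of_real t) = u t"
proof -
  let ?U = "initial_term u\<^sub>a g"
  note ray = contour_integral_ray[OF star Q holomorphic_on_imp_continuous_on[OF g] g_le]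
  have hol: "?U holomorphic_on D"
    unfolding initial_term_def[abs_def]
    by (intro holomorphic_intros ray_primitive_holomorphic[OF g Q g_le])
  have cQ: "continuous_on {0..} Q"
    using Q by (simp add: antiderivative_off_def)
  have "continuous_on {0..} (\<lambda>s. (norm u\<^sub>a + Q s) / weight s)"
    unfolding weight_def by (intro continuous_intros cQ) auto
  then obtain C where C: "C > 0"
    "\<And>z. z \<in> D \<Longrightarrow> (norm u\<^sub>a + Q (norm (z - of_real a))) / weight (norm (z - of_real a)) \<le> C"
    by (rule bounded_on_D) blast
  have le: "norm (?U z) \<le> C * weight (norm (z - of_real a))" if "z \<in> D" for z
  proof -
    have "norm (?U z) \<le> norm u\<^sub>a + Q (norm (z - of_real a))"
      unfolding initial_term_def using ray(2)[OF _ _ that] Q_0 norm_triangle_ineq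
      by (smt (verit))
    then show ?thesis
      using C(2)[OF that] weight_pos[of "norm (z - of_real a)"] by (simp add: pos_divide_le_eq)
  qed
  have ab: "a < b"
    using b by simp
  have Tu: "real_op_maps u (\<lambda>t. u t - ?U (of_real t))"
    unfolding real_op_maps_def
  proof (intro conjI ballI)
    fix t assume t: "t \<in> {a<..<b}"
    then have tD: "of_real t \<in> D"
      using real_in_D by simp
    show "(\<lambda>r. k (of_real t) (of_real r) * u r) integrable_on {a..t}"
      using u t unfolding solves_IVP_def by simp
    have g_int: "((\<lambda>s. g (of_real s)) has_integral ?U (of_real t) - u\<^sub>a) {a..t}"
      using has_integral_linepath_real[OF ray(1)[OF _ _ tD]] t by (simp add: initial_term_def)
    have "((\<lambda>s. g (of_real s) + \<mu> (of_real s) * u s + volterra_real k a u s)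
        has_integral (u t - u\<^sub>a)) {a..t}"
      using u t unfolding solves_IVP_def by simp
    from has_integral_diff[OF this g_int]
    show "((\<lambda>s. \<mu> (of_real s) * u s + volterra_real k a u s)
        has_integral u t - ?U (of_real t)) {a..t}"
      by (simp add: algebra_simps)
  qed
  obtain B where B: "\<And>t. t \<in> {a..b} \<Longrightarrow> norm (u t) \<le> B"
  proof -
    define h where "h s = g (of_real s) + \<mu> (of_real s) * u s + volterra_real k a u s" for s
    have h: "(h has_integral (u t - u\<^sub>a)) {a..t}" if "t \<in> {a..b}" for t
      using u that unfolding solves_IVP_def h_def by simp
    have "h integrable_on {a..b}"
      using h[of b] ab by auto
    then have "continuous_on {a..b} (\<lambda>t. u\<^sub>a + integral {a..t} h)"
      by (intro continuous_intros indefinite_integral_continuous_1)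
    moreover have "u\<^sub>a + integral {a..t} h = u t" if "t \<in> {a..b}" for t
      using integral_unique[OF h[OF that]] by simp
    ultimately have "continuous_on {a..b} u"
      by (rule continuous_on_eq)
    then have "bounded (u ` {a..b})"
      by (intro compact_imp_bounded compact_continuous_image) auto
    then show ?thesis
      using that unfolding bounded_iff by blast
  qed
  show ?thesis
  proof (rule that)
    show "(\<lambda>z. \<Sum>n. (volterra_op ^^ n) ?U z) holomorphic_on D"
      by (rule neumann_series(1)[OF hol le]) (use C in auto)
    show "norm (\<Sum>n. (volterra_op ^^ n) ?U w) \<le> 2 * C * weight (norm (w - of_real a))" if "w \<in> D" for w
      by (rule neumann_series(2)[OF hol le _ that]) (use C in auto)
    show "(\<Sum>n. (volterra_op ^^ n) ?U (of_real t)) = u t" if "a < t" "t < b" for t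
      by (rule real_solution_eq_neumann_series[where B = B, OF hol le _ Tu _ that, symmetric]) (use B C in auto)
  qed (use C in auto)
qed

end

section \<open>Membership in the function spaces\<close>

lemma antiderivative_off_majorant:
  assumes "0 < \<alpha>"
  shows "antiderivative_off L (\<lambda>s. K * majorant_int \<alpha> L s) (\<lambda>s. K * majorant \<alpha> L s)"
  unfolding antiderivative_off_def
  using assms by (auto intro!: continuous_intros continuous_on_majorant_int DERIV_cmult DERIV_majorant_int)

lemma L_space_quotient_le_majorant:
  assumes "0 < \<alpha>" "\<alpha> \<le> 1" "a < b" and w: "w \<noteq> of_real a" "w \<noteq> of_real b" "norm (w - of_real a) \<noteq> b - a"
    and le: "norm (f * Qfun a b w) \<le> K * norm (Qfun a b w) powr \<alpha>" and "K \<le> K'" "0 \<le> K'"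
  shows "norm f \<le> K' * majorant \<alpha> (b - a) (norm (w - of_real a))"
proof -
  have pos: "norm (Qfun a b w) > 0"
    using w by (simp add: Qfun_def)
  have "norm f * norm (Qfun a b w) \<le> K * norm (Qfun a b w) powr (\<alpha> - 1) * norm (Qfun a b w)"
    using le pos by (simp add: norm_mult powr_diff)
  then have "norm f \<le> K * norm (Qfun a b w) powr (\<alpha> - 1)"
    using pos by simp
  also have "\<dots> \<le> K' * majorant \<alpha> (b - a) (norm (w - of_real a))"
    using Qfun_powr_le_majorant[of \<alpha> a b w] assms by (intro mult_mono) auto
  finally show ?thesis .
qed

text \<open>
  The constant \<open>K * B\<close> is stated explicitly so that it can be seen to be uniform over a family of \<open>f\<close>.
\<close>

lemma L_space_mult_bounded:
  assumes D: "open D" and f: "(\<lambda>z. f z * Qfun a b z) \<in> L_space a b \<alpha> D"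
    and f_le: "\<And>z. z \<in> D \<Longrightarrow> norm (f z * Qfun a b z) \<le> K * norm (Qfun a b z) powr \<alpha>"
    and U: "U holomorphic_on D" "\<And>z. z \<in> D \<Longrightarrow> norm (U z) \<le> B"
  shows "(\<lambda>z. f z * U z * Qfun a b z) \<in> L_space a b \<alpha> D"
    and "\<And>z. z \<in> D \<Longrightarrow> norm (f z * U z * Qfun a b z) \<le> K * B * norm (Qfun a b z) powr \<alpha>"
proof -
  show le: "norm (f z * U z * Qfun a b z) \<le> K * B * norm (Qfun a b z) powr \<alpha>" if "z \<in> D" for z
  proof -
    have "norm (f z * Qfun a b z) * norm (U z) \<le> (K * norm (Qfun a b z) powr \<alpha>) * B"
      using f_le[OF that] U(2)[OF that] order_trans[OF norm_ge_zero f_le[OF that]]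
      by (intro mult_mono) auto
    then show ?thesis
      by (simp add: norm_mult mult_ac)
  qed
  have "(\<lambda>z. f z * Qfun a b z) holomorphic_on D"
    using f D by (auto simp: L_space_def analytic_on_open)
  then have "(\<lambda>z. (f z * Qfun a b z) * U z) holomorphic_on D"
    using U(1) by (rule holomorphic_on_mult)
  then have "(\<lambda>z. f z * U z * Qfun a b z) analytic_on D"
    using D by (simp add: analytic_on_open mult_ac)
  then show "(\<lambda>z. f z * U z * Qfun a b z) \<in> L_space a b \<alpha> D"
    using le unfolding L_space_def by blast
qed

lemma holomorphic_quotient_Qfun:
  assumes "(\<lambda>z. f z * Qfun a b z) holomorphic_on D" "of_real a \<notin> D" "of_real b \<notin> D"
  shows "f holomorphic_on D"
proof -
  have ne: "Qfun a b z \<noteq> 0" if "z \<in> D" for z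
    using assms that by (auto simp: Qfun_def)
  have "(\<lambda>z. f z * Qfun a b z / Qfun a b z) holomorphic_on D"
    using assms(1) ne by (intro holomorphic_on_divide) (auto simp: Qfun_def intro!: holomorphic_intros)
  then show ?thesis
    by (rule holomorphic_transform) (use ne in auto)
qed

theorem theorem3p2:
  fixes a b \<alpha> d :: real and u\<^sub>a :: complex and D :: "complex set"
    and g \<mu> :: "complex \<Rightarrow> complex" and k :: "complex \<Rightarrow> complex \<Rightarrow> complex"
    and u :: "real \<Rightarrow> complex"
  assumes "a < b" and "0 < \<alpha>" and "\<alpha> \<le> 1" and "0 < d" and "d < pi"
    and D: "D = psi_SE a b ` strip d"
    and g: "(\<lambda>z. g z * Qfun a b z) \<in> L_space a b \<alpha> D"
    and \<mu>: "(\<lambda>z. \<mu> z * Qfun a b z) \<in> L_space a b \<alpha> D"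
    and k_snd: "L_space_uniformly a b \<alpha> D D (\<lambda>z w. k z w * Qfun a b w)"
    and k_fst: "\<And>w. w \<in> D \<Longrightarrow> (\<lambda>z. k z w * Qfun a b w) \<in> H_infty D"
    and k_endpoints: "\<And>s. s \<in> {a, b} \<Longrightarrow> (\<lambda>w. k (of_real s) w * Qfun a b w) \<in> L_space a b \<alpha> D"
    and u: "solves_IVP a b u\<^sub>a g \<mu> k u"
  shows "\<exists>U. U analytic_on D \<and> (\<forall>t\<in>{a..b}. U (of_real t) = u t) \<and>
    (\<forall>z\<in>D. (\<lambda>w. k z w * U w) contour_integrable_on linepath (of_real a) z) \<and>
    (\<forall>s\<in>{a<..<b}. volterra k a U (of_real s) = volterra_real k a u s) \<and>
    (\<lambda>z. g z * Qfun a b z) \<in> L_space a b \<alpha> D \<and>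
    (\<lambda>z. \<mu> z * U z * Qfun a b z) \<in> L_space a b \<alpha> D \<and>
    (\<lambda>z. volterra k a U z * Qfun a b z) \<in> L_space a b \<alpha> D \<and>
    L_space_uniformly a b \<alpha> D {a..b} (\<lambda>s w. k (of_real s) w * U w * Qfun a b w)"
proof -
  note psi = \<open>a < b\<close> \<open>0 < d\<close> \<open>d < pi\<close>
  have oD: "open D" and notin: "of_real a \<notin> D" "of_real b \<notin> D"
    and real_in_D: "\<And>t. a < t \<Longrightarrow> t < b \<Longrightarrow> of_real t \<in> D"
    unfolding D
    by (fact open_psi_SE_image[OF psi] notin_psi_SE_image[OF psi] real_interval_subset_psi_SE_image[OF psi])+
  define M where "M = (b - a) / sin d"
  have M: "norm (z - of_real a) \<le> M" if "z \<in> D" for z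
    using psi_SE_image_bounded psi that unfolding D M_def by blast
  have star: "contains_rays (of_real a) D"
    unfolding contains_rays_def
  proof (intro conjI ballI notin)
    fix z t assume "z \<in> D" "t \<in> {0<..1::real}"
    then have "of_real a + of_real t * (z - of_real a) \<in> D"
      using psi_SE_image_ray[OF psi, of z t] unfolding D by auto
    then show "linepath (of_real a) z t \<in> D"
      by (simp add: linepath_def scaleR_conv_of_real algebra_simps)
  qed
  obtain Kg where Kg: "\<And>z. z \<in> D \<Longrightarrow> norm (g z * Qfun a b z) \<le> Kg * norm (Qfun a b z) powr \<alpha>"
    using g by (auto simp: L_space_def)
  obtain K\<mu> where K\<mu>: "\<And>z. z \<in> D \<Longrightarrow> norm (\<mu> z * Qfun a b z) \<le> K\<mu> * norm (Qfun a b z) powr \<alpha>"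
    using \<mu> by (auto simp: L_space_def)
  obtain Kk where Kk: "\<And>z w. z \<in> D \<Longrightarrow> w \<in> D \<Longrightarrow> norm (k z w * Qfun a b w) \<le> Kk * norm (Qfun a b w) powr \<alpha>"
    using k_snd by (auto simp: L_space_uniformly_def)
  have k_L: "(\<lambda>w. k z w * Qfun a b w) \<in> L_space a b \<alpha> D" if "z \<in> D" for z
    using k_snd that by (auto simp: L_space_uniformly_def)
  define K where "K = \<bar>Kg\<bar> + \<bar>K\<mu>\<bar> + \<bar>Kk\<bar>"
  note le_majorant = L_space_quotient_le_majorant[OF \<open>0 < \<alpha>\<close> \<open>\<alpha> \<le> 1\<close> \<open>a < b\<close>, where K' = K]
  have ne: "w \<noteq> of_real a" "w \<noteq> of_real b" if "w \<in> D" for w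
    using notin that by auto
  have kQ_hol1: "(\<lambda>z. k z w * Qfun a b w) holomorphic_on D" if "w \<in> D" for w
    using k_fst[OF that] oD by (simp add: H_infty_def analytic_on_open)
  have kQ_hol2: "(\<lambda>w. k z w * Qfun a b w) holomorphic_on D" if "z \<in> D" for z
    using k_L[OF that] oD by (simp add: L_space_def analytic_on_open)
  have Q_bound: "norm (Qfun a b w) \<le> M * (M + (b - a))" if "w \<in> D" for w
  proof -
    have "norm (of_real b - w) \<le> norm (of_real (b - a) :: complex) + norm (w - of_real a)"
      using norm_triangle_ineq4[of "of_real (b - a)" "w - of_real a"] by simp
    also have "\<dots> \<le> M + (b - a)"
      using M[OF that] \<open>a < b\<close> by (simp del: of_real_diff)
    finally show ?thesis
      unfolding Qfun_def norm_mult using M[OF that] order_trans[OF norm_ge_zero M[OF that]]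
      by (intro mult_mono) auto
  qed
  have k_cont: "continuous_on (D \<times> D) (\<lambda>(z, w). k z w)"
  proof -
    have "continuous_on (D \<times> D) (\<lambda>(z, w). k z w * Qfun a b w)"
    proof (rule bounded_separately_holomorphic_imp_continuous[OF oD kQ_hol1])
      show "norm (k z w * Qfun a b w) \<le> \<bar>Kk\<bar> * (M * (M + (b - a))) powr \<alpha>" if "z \<in> D" "w \<in> D" for z w
      proof -
        have "norm (k z w * Qfun a b w) \<le> Kk * norm (Qfun a b w) powr \<alpha>"
          by (rule Kk[OF that])
        also have "\<dots> \<le> \<bar>Kk\<bar> * (M * (M + (b - a))) powr \<alpha>"
          using Q_bound[OF that(2)] \<open>0 < \<alpha>\<close> by (intro mult_mono powr_mono2) auto
        finally show ?thesis .
      qed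
    qed (use kQ_hol2 in \<open>auto intro: holomorphic_on_imp_continuous_on\<close>)
    then have "continuous_on (D \<times> D) (\<lambda>p. k (fst p) (snd p) * Qfun a b (snd p) / Qfun a b (snd p))"
      unfolding split_def using ne
      by (intro continuous_on_divide) (auto simp: Qfun_def intro!: continuous_intros)
    then show ?thesis
      unfolding split_def
    proof (rule continuous_on_eq)
      fix p assume "p \<in> D \<times> D"
      then have "Qfun a b (snd p) \<noteq> 0"
        using ne[of "snd p"] by (auto simp: Qfun_def)
      then show "k (fst p) (snd p) * Qfun a b (snd p) / Qfun a b (snd p) = k (fst p) (snd p)"
        by simp
    qed
  qed
  have k_hol1: "(\<lambda>z. k z w) holomorphic_on D" if "w \<in> D" for w
  proof -
    have "(\<lambda>z. k z w * Qfun a b w / Qfun a b w) holomorphic_on D"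
      using kQ_hol1[OF that] ne[OF that] by (intro holomorphic_on_divide) (auto simp: Qfun_def)
    then show ?thesis
      using ne[OF that] by (simp add: Qfun_def)
  qed
  have L_hol: "f holomorphic_on D" if "(\<lambda>z. f z * Qfun a b z) \<in> L_space a b \<alpha> D" for f
  proof (rule holomorphic_quotient_Qfun[OF _ notin])
    show "(\<lambda>z. f z * Qfun a b z) holomorphic_on D"
      using that oD by (simp add: L_space_def analytic_on_open)
  qed
  interpret real_volterra_equation a D "b - a" M "\<lambda>s. K * majorant_int \<alpha> (b - a) s" "\<lambda>s. K * majorant \<alpha> (b - a) s" \<mu> k b
  proof (unfold_locales; (rule oD star antiderivative_off_majorant M k_cont)?)
    show "\<mu> holomorphic_on D"
      using \<mu> by (rule L_hol)
    show "k z holomorphic_on D" if "z \<in> D" for z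
      using k_L[OF that] by (rule L_hol)
    show "norm (\<mu> w) \<le> K * majorant \<alpha> (b - a) (norm (w - of_real a))"
      if "w \<in> D" "norm (w - of_real a) \<noteq> b - a" for w
      by (rule le_majorant[OF ne[OF that(1)] that(2) K\<mu>[OF that(1)]]) (auto simp: K_def)
    show "norm (k z w) \<le> K * majorant \<alpha> (b - a) (norm (w - of_real a))"
      if "z \<in> D" "w \<in> D" "norm (w - of_real a) \<noteq> b - a" for z w
      by (rule le_majorant[OF ne[OF that(2)] that(3) Kk[OF that(1,2)]]) (auto simp: K_def)
  qed (use \<open>a < b\<close> \<open>0 < \<alpha>\<close> real_in_D k_hol1 in \<open>auto simp: K_def majorant_int_0 majorant_nonneg\<close>)
  have g_hol: "g holomorphic_on D"
    using g by (rule L_hol)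
  have g_le: "norm (g w) \<le> K * majorant \<alpha> (b - a) (norm (w - of_real a))"
    if "w \<in> D" "norm (w - of_real a) \<noteq> b - a" for w
    by (rule le_majorant[OF ne[OF that(1)] that(2) Kg[OF that(1)]]) (auto simp: K_def)
  obtain U\<^sub>0 C where C: "0 \<le> C" and U\<^sub>0: "U\<^sub>0 holomorphic_on D"
    "\<And>w. w \<in> D \<Longrightarrow> norm (U\<^sub>0 w) \<le> C * weight (norm (w - of_real a))"
    "\<And>t. a < t \<Longrightarrow> t < b \<Longrightarrow> U\<^sub>0 (of_real t) = u t"
    by (rule IVP_solution_extends[OF g_hol _ u], erule (1) g_le, rule that)
  \<comment> \<open>The end points lie outside \<open>D\<close>, so prescribing the values there does not affect analyticity.\<close>
  define U where "U z = (if z \<in> D then U\<^sub>0 z else u (Re z))" for z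
  have U_hol: "U holomorphic_on D"
    using U\<^sub>0(1) by (rule holomorphic_transform) (simp add: U_def)
  have U_le: "norm (U w) \<le> C * weight (norm (w - of_real a))" if "w \<in> D" for w
    using U\<^sub>0(2)[OF that] that by (simp add: U_def)
  have U_real: "U (of_real t) = u t" if "t \<in> {a..b}" for t
    using that notin U\<^sub>0(3)[of t] by (cases "t = a \<or> t = b") (auto simp: U_def)
  obtain B where B: "\<And>w. w \<in> D \<Longrightarrow> norm (U w) \<le> B"
    using weighted_bound_imp_bounded[OF U_le C] by blast
  note V = volterra_weighted[OF U_hol U_le C]
  obtain B' where B': "B' > 0" "\<And>z. z \<in> D \<Longrightarrow> norm (volterra k a U z) \<le> B'"
    using weighted_bound_imp_bounded[OF V(2)] C by auto
  have V_real: "volterra k a U (of_real s) = volterra_real k a u s" if "s \<in> {a<..<b}" for s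
  proof -
    have "volterra k a U (of_real s) = volterra_real k a (\<lambda>r. U (of_real r)) s"
      using that by (intro volterra_of_real) auto
    also have "\<dots> = volterra_real k a u s"
      unfolding volterra_real_def using that by (intro Henstock_Kurzweil_Integration.integral_cong) (auto simp: U_real)
    finally show ?thesis .
  qed
  have V_L: "(\<lambda>z. volterra k a U z * Qfun a b z) \<in> L_space a b \<alpha> D"
    unfolding L_space_def
  proof (intro CollectI conjI exI ballI)
    have "Qfun a b holomorphic_on D"
      unfolding Qfun_def[abs_def] by (intro holomorphic_intros)
    then show "(\<lambda>z. volterra k a U z * Qfun a b z) analytic_on D"
      using V(3) oD by (auto simp: analytic_on_open intro!: holomorphic_intros)
    fix z assume z: "z \<in> D"
    have pos: "norm (Qfun a b z) > 0"
      using ne[OF z] by (simp add: Qfun_def)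
    then have "norm (Qfun a b z) = norm (Qfun a b z) powr (1 - \<alpha>) * norm (Qfun a b z) powr \<alpha>"
      by (simp flip: powr_add)
    also have "\<dots> \<le> (M * (M + (b - a))) powr (1 - \<alpha>) * norm (Qfun a b z) powr \<alpha>"
      using Q_bound[OF z] \<open>\<alpha> \<le> 1\<close> by (intro mult_right_mono powr_mono2) auto
    finally have "norm (volterra k a U z * Qfun a b z)
        \<le> B' * ((M * (M + (b - a))) powr (1 - \<alpha>) * norm (Qfun a b z) powr \<alpha>)"
      unfolding norm_mult using B'(1) B'(2)[OF z] by (intro mult_mono) auto
    then show "norm (volterra k a U z * Qfun a b z)
        \<le> (B' * (M * (M + (b - a))) powr (1 - \<alpha>)) * norm (Qfun a b z) powr \<alpha>"
      by (simp add: mult.assoc)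
  qed
  have kU: "L_space_uniformly a b \<alpha> D {a..b} (\<lambda>s w. k (of_real s) w * U w * Qfun a b w)"
  proof -
    obtain Ka where Ka: "\<And>w. w \<in> D \<Longrightarrow> norm (k (of_real a) w * Qfun a b w) \<le> Ka * norm (Qfun a b w) powr \<alpha>"
      using k_endpoints[of a] by (auto simp: L_space_def)
    obtain Kb where Kb: "\<And>w. w \<in> D \<Longrightarrow> norm (k (of_real b) w * Qfun a b w) \<le> Kb * norm (Qfun a b w) powr \<alpha>"
      using k_endpoints[of b] by (auto simp: L_space_def)
    \<comment> \<open>The open interval is covered by the uniform bound on \<open>D\<close>; only the two end points are added.\<close>
    define K' where "K' = max Kk (max Ka Kb)"
    have cases: "s = a \<or> s = b \<or> of_real s \<in> D" if "s \<in> {a..b}" for s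
      using that real_in_D[of s] by force
    have L: "(\<lambda>w. k (of_real s) w * Qfun a b w) \<in> L_space a b \<alpha> D" if "s \<in> {a..b}" for s
      using cases[OF that] k_endpoints k_L by auto
    have le: "norm (k (of_real s) w * Qfun a b w) \<le> K' * norm (Qfun a b w) powr \<alpha>"
      if "s \<in> {a..b}" "w \<in> D" for s w
    proof -
      have *: "x * norm (Qfun a b w) powr \<alpha> \<le> K' * norm (Qfun a b w) powr \<alpha>" if "x \<le> K'" for x
        using that by (intro mult_right_mono) auto
      show ?thesis
        using cases[OF that(1)] order_trans[OF Ka[OF that(2)] *] order_trans[OF Kb[OF that(2)] *]
          order_trans[OF Kk[OF _ that(2)] *] by (auto simp: K'_def)
    qed
    show ?thesis
      unfolding L_space_uniformly_def
      using L_space_mult_bounded[OF oD L le U_hol B] by blast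
  qed
  show ?thesis
  proof (intro exI[of _ U] conjI ballI)
    show "U analytic_on D"
      using U_hol oD by (simp add: analytic_on_open)
    show "(\<lambda>z. \<mu> z * U z * Qfun a b z) \<in> L_space a b \<alpha> D"
      by (rule L_space_mult_bounded(1)[OF oD \<mu> K\<mu> U_hol B])
  qed (use U_real V(1) V_real g V_L kU in auto)
qed

end
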